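(* There is an absolute constant $C>0$ such that for all $\Delta\in\mathbb{N}$ and all $d>2^{20\Delta}$, with high probability (i.e. with probability tending to $1$ as $n\to\infty$) the random graph $G(n,d/n)$ contains every tree with maximum degree at most $\Delta$ and order at most $\frac{Cn}{d\log^2(d)}$ as an induced subgraph.
   Context: $G(n,p)$ denotes the Erdős–Rényi random graph on $n$ vertices in which each pair of vertices is joined by an edge independently with probability $p$. *)

theory Defs
  imports "HOL-Probability.Probability"
begin

text \<open>Simple graphs on vertex set {0..<n}: an edge set E of 2-element subsets.\<close>

definition all_pairs :: "nat \<Rightarrow> nat set set" where
  "all_pairs n = {e. \<exists>i j. i < j \<and> j < n \<and> e = {i, j}}"

definition is_graph :: "nat \<Rightarrow> nat set set \<Rightarrow> bool" where
  "is_graph n E \<longleftrightarrow> E \<subseteq> all_pairs n"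

text \<open>Erdos-Renyi random graph G(n,p): each pair independently an edge with probability p
  (bernoulli_pmf clamps p to [0,1]).\<close>
definition gnp :: "nat \<Rightarrow> real \<Rightarrow> nat set set pmf" where
  "gnp n p = map_pmf (\<lambda>f. {e. f e}) (Pi_pmf (all_pairs n) False (\<lambda>_. bernoulli_pmf p))"

definition adj :: "nat set set \<Rightarrow> nat \<Rightarrow> nat \<Rightarrow> bool" where
  "adj E u v \<longleftrightarrow> {u, v} \<in> E"

definition connected_graph :: "nat \<Rightarrow> nat set set \<Rightarrow> bool" where
  "connected_graph n E \<longleftrightarrow>
     (\<forall>u<n. \<forall>v<n. (u, v) \<in> {(x, y). adj E x y}\<^sup>*)"

text \<open>A cycle: a list of at least 3 distinct vertices, consecutive ones adjacent,
  last adjacent to first.\<close>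
definition has_cycle :: "nat \<Rightarrow> nat set set \<Rightarrow> bool" where
  "has_cycle n E \<longleftrightarrow> (\<exists>vs. length vs \<ge> 3 \<and> distinct vs \<and> set vs \<subseteq> {0..<n} \<and>
     (\<forall>i. Suc i < length vs \<longrightarrow> adj E (vs ! i) (vs ! Suc i)) \<and>
     adj E (last vs) (hd vs))"

definition is_tree :: "nat \<Rightarrow> nat set set \<Rightarrow> bool" where
  "is_tree m E \<longleftrightarrow> m \<ge> 1 \<and> is_graph m E \<and> connected_graph m E \<and> \<not> has_cycle m E"

definition degree :: "nat set set \<Rightarrow> nat \<Rightarrow> nat" where
  "degree E v = card {u. adj E v u}"

definition max_degree_le :: "nat \<Rightarrow> nat set set \<Rightarrow> nat \<Rightarrow> bool" where
  "max_degree_le m E \<Delta> \<longleftrightarrow> (\<forall>v<m. degree E v \<le> \<Delta>)"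

text \<open>Graph (m, F) is an induced subgraph of graph (n, E).\<close>
definition induced_subgraph :: "nat \<Rightarrow> nat set set \<Rightarrow> nat \<Rightarrow> nat set set \<Rightarrow> bool" where
  "induced_subgraph m F n E \<longleftrightarrow> (\<exists>f. inj_on f {0..<m} \<and> f ` {0..<m} \<subseteq> {0..<n} \<and>
     (\<forall>u<m. \<forall>v<m. u \<noteq> v \<longrightarrow> ({u, v} \<in> F \<longleftrightarrow> {f u, f v} \<in> E)))"

end

theory Submission
  imports Defs
begin

text \<open>
  Restrict \<open>G(n, d/n)\<close> to the first \<open>N = 1000 \<Delta> n / d\<close> vertices. With high probability the resulting
  graph has more than \<open>(58 \<Delta> + 36) N\<close> edges, hence a nonempty induced subgraph of minimum degree
  \<open>58 \<Delta> + 36\<close>, and its small vertex sets \<open>U\<close> span at most \<open>3|U|/2\<close> (for even smaller ones \<open>4|U|/3\<close>)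
  edges. In such a graph every tree is embedded deterministically by a pre-emptive greedy algorithm:
  whenever some vertex, embedded or not, has too many neighbours that are no longer usable as
  children, \<open>\<Delta>\<close> children are reserved for it immediately. Sparsity shows that only
  a small fraction of the vertices ever needs this treatment, and that among the vertices waiting for
  it there is always one that can be served without harming the others.
\<close>

section \<open>Pre-emptive greedy embedding in sparse graphs\<close>

text \<open>In an induced embedding every chosen vertex spoils its neighbours for all other parents,
  so plain greedy choices can leave a tree vertex without usable neighbours when its turn comes.
  Edge counting cannot say which vertices get into this position, only that they are few; hence
  children are reserved early. Reservations occupy vertices and may trigger further ones, and the
  constants keep this feedback below \<open>b\<close>. The passage to \<open>N\<close> vertices is
  forced by the first moment method: at average degree \<open>D\<close> it gives edge density at
  most 3/2 for sets up to order N / D^3, and at most 4/3 up to order N / D^4. For the whole graph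
  the first bound is only n / d^3. With \<open>D\<close> of order \<Delta> and \<open>N\<close> of
  order \<Delta> n / d, the two become n / (d \<Delta>^2) and n / (d \<Delta>^3). The smaller range
  suffices for density 4/3, because that density is applied only to sets of size at most 51 b + 7,
  where \<open>b\<close> is about M / (3 \<Delta>). Finally d > 2^(20 \<Delta>) gives \<Delta> \<le>
  ln d, which turns \<Delta>^2 into the squared logarithm.\<close>

locale sparse_graph =
  fixes V :: "'a set" and nb :: "'a \<Rightarrow> 'a set" and \<Delta> b M u0 u1 :: nat
  assumes finite_V: "finite V"
    and nb_subset: "nb x \<subseteq> V"
    and nb_sym: "y \<in> nb x \<longleftrightarrow> x \<in> nb y"
    and nb_irrefl: "x \<notin> nb x"
    and min_degree: "x \<in> V \<Longrightarrow> 58 * \<Delta> + 36 \<le> card (nb x)"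
    and sparse0: "U \<subseteq> V \<Longrightarrow> card U \<le> u0 \<Longrightarrow> (\<Sum>x\<in>U. card (nb x \<inter> U)) \<le> 3 * card U"
    and sparse1: "U \<subseteq> V \<Longrightarrow> card U \<le> u1 \<Longrightarrow> 3 * (\<Sum>x\<in>U. card (nb x \<inter> U)) \<le> 8 * card U"
    \<comment> \<open>\<open>M\<close> bounds the order of the tree and \<open>b\<close> the number
      of triggered vertices. \<open>u0\<close> has room for the occupied set and for b + 1 triggered
      vertices with 12 + 48 \<Delta> blocked neighbours each. \<open>u1\<close> has room for
      \<open>b\<close> pending vertices with 50 further vertices each; its 7 is for two vertices
      with five common neighbours.\<close>
    and u0_ge: "M + \<Delta> * b + (b + 1) * (13 + 48 * \<Delta>) \<le> u0"
    and u1_ge: "51 * b + 7 \<le> u1"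
    and b_ge: "M \<le> 3 * \<Delta> * (b + 1)"
    and Delta_pos: "\<Delta> \<ge> 1"
begin

section \<open>Degree counts, codegrees and independent sets\<close>

lemma finite_nb [simp]: "finite (nb x)"
  using nb_subset finite_V finite_subset by blast

lemma finite_sub_V: "A \<subseteq> V \<Longrightarrow> finite A"
  using finite_V finite_subset by blast

lemma sum_nb_swap:
  assumes "finite A" "finite B"
  shows "(\<Sum>x\<in>A. card (nb x \<inter> B)) = (\<Sum>y\<in>B. card (nb y \<inter> A))"
proof -
  have *: "card (nb x \<inter> B) = (\<Sum>y\<in>B. if y \<in> nb x then 1 else 0)" if "finite B" for x B
    using that by (simp add: sum.If_cases Int_commute Collect_conj_eq[symmetric])
  show ?thesis
    using assms by (simp add: * nb_sym sum.swap[of _ B A])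
qed

text \<open>Edges inside \<open>Q\<close> are dropped, and edges between \<open>W\<close> and
  \<open>Q\<close> count from both ends. If each summand on the left exceeds the average degree that
  sparsity allows, the size of \<open>W\<close> is at most a constant times that of
  \<open>Q\<close>.\<close>

lemma degree_sum_ge:
  assumes "finite W" "finite Q" "W \<inter> Q = {}"
  shows "(\<Sum>w\<in>W. 2 * card (nb w \<inter> Q) + card (nb w \<inter> W)) \<le> (\<Sum>x\<in>W \<union> Q. card (nb x \<inter> (W \<union> Q)))"
proof -
  have split: "card (nb x \<inter> (W \<union> Q)) = card (nb x \<inter> W) + card (nb x \<inter> Q)" for x
    using assms by (subst card_Un_disjoint[symmetric]) (auto simp: Int_Un_distrib)
  have "(\<Sum>x\<in>W \<union> Q. card (nb x \<inter> (W \<union> Q))) =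
    (\<Sum>x\<in>W. card (nb x \<inter> W) + card (nb x \<inter> Q)) + (\<Sum>x\<in>Q. card (nb x \<inter> W) + card (nb x \<inter> Q))"
    using assms by (simp add: sum.union_disjoint split)
  also have "\<dots> \<ge> (\<Sum>x\<in>W. card (nb x \<inter> W) + card (nb x \<inter> Q)) + (\<Sum>x\<in>Q. card (nb x \<inter> W))"
    by (intro add_left_mono sum_mono) auto
  also have "(\<Sum>x\<in>Q. card (nb x \<inter> W)) = (\<Sum>w\<in>W. card (nb w \<inter> Q))"
    using sum_nb_swap[OF assms(2,1)] .
  finally show ?thesis by (simp add: sum.distrib mult_2)
qed

text \<open>Five common neighbours would give 7 vertices spanning 10 edges: degree sum at least 20,
  but 3 * 20 > 8 * 7.\<close>

lemma codegree_le:
  assumes "x \<noteq> y"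
  shows "card (nb x \<inter> nb y) \<le> 4"
proof (rule ccontr)
  assume "\<not> ?thesis"
  then have "5 \<le> card (nb x \<inter> nb y)" by simp
  then obtain S where S: "S \<subseteq> nb x \<inter> nb y" "card S = 5" "finite S"
    by (meson obtain_subset_with_card_n)
  let ?Q = "{x, y}"
  have xy: "x \<in> V" "y \<in> V"
    using S nb_sym nb_subset by (metis Int_iff card.empty ex_in_conv subsetD zero_neq_numeral)+
  have disj: "S \<inter> ?Q = {}" using S nb_irrefl by auto
  have c: "card (S \<union> ?Q) = 7"
    using S disj assms by (simp add: card_Un_disjoint)
  have "card (nb w \<inter> ?Q) = 2" if "w \<in> S" for w
  proof -
    have "nb w \<inter> ?Q = ?Q" using that S nb_sym by auto
    then show ?thesis using assms by simp
  qed
  then have "20 \<le> (\<Sum>w\<in>S. 2 * card (nb w \<inter> ?Q) + card (nb w \<inter> S))"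
    using S by (simp add: sum.distrib)
  also have "\<dots> \<le> (\<Sum>x\<in>S \<union> ?Q. card (nb x \<inter> (S \<union> ?Q)))"
    using S disj by (intro degree_sum_ge) auto
  finally have "20 \<le> (\<Sum>x\<in>S \<union> ?Q. card (nb x \<inter> (S \<union> ?Q)))" .
  moreover have "3 * (\<Sum>x\<in>S \<union> ?Q. card (nb x \<inter> (S \<union> ?Q))) \<le> 8 * card (S \<union> ?Q)"
    using S xy nb_subset c u1_ge by (intro sparse1) auto
  ultimately show False using c by linarith
qed

text \<open>Greedy: each chosen vertex discards itself and at most 4 neighbours. It is applied
  inside a neighbourhood, where \<open>codegree_le\<close> supplies the 4.\<close>

lemma independent_subset:
  assumes "finite A" "5 * k \<le> card A" "\<And>y. y \<in> A \<Longrightarrow> card (nb y \<inter> A) \<le> 4"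
  shows "\<exists>Y\<subseteq>A. card Y = k \<and> (\<forall>y\<in>Y. nb y \<inter> Y = {})"
  using assms
proof (induction k arbitrary: A)
  case 0
  then show ?case by (intro exI[of _ "{}"]) auto
next
  case (Suc k)
  then obtain y where y: "y \<in> A" by fastforce
  let ?A = "A - insert y (nb y)"
  have "card (insert y (nb y \<inter> A)) \<le> 5"
    using Suc.prems(3)[OF y] by (simp add: card_insert_if)
  moreover have "?A = A - insert y (nb y \<inter> A)" by auto
  ultimately have "5 * k \<le> card ?A"
    using Suc.prems(2) diff_card_le_card_Diff[of "insert y (nb y \<inter> A)" A] by simp
  moreover have "card (nb z \<inter> ?A) \<le> 4" if "z \<in> ?A" for z
  proof -
    have "card (nb z \<inter> ?A) \<le> card (nb z \<inter> A)" by (intro card_mono) auto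
    then show ?thesis using Suc.prems(3)[of z] that by auto
  qed
  ultimately obtain Y where Y: "Y \<subseteq> ?A" "card Y = k" "\<forall>y\<in>Y. nb y \<inter> Y = {}"
    using Suc.IH[of ?A] Suc.prems(1) by auto
  have "finite Y" using Y(1) Suc.prems(1) by (meson finite_Diff finite_subset)
  then have "card (insert y Y) = Suc k" using Y by (subst card_insert_disjoint) auto
  moreover have "\<forall>z\<in>insert y Y. nb z \<inter> insert y Y = {}"
    using Y nb_irrefl nb_sym by blast
  ultimately show ?case using Y(1) y by (intro exI[of _ "insert y Y"]) auto
qed

text \<open>A state consists of a root \<open>r\<close>, a set \<open>S\<close> of served vertices and the children \<open>C w\<close> reserved for
  each served \<open>w\<close>. A vertex may be served before it is itself occupied; its reserved children
  then do not count against it when it is chosen as somebody's child later.\<close>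

definition occupied :: "'a \<Rightarrow> ('a \<Rightarrow> 'a set) \<Rightarrow> 'a set" where
  "occupied r C = insert r (\<Union>w. C w)"

definition blocked :: "'a \<Rightarrow> ('a \<Rightarrow> 'a set) \<Rightarrow> 'a \<Rightarrow> 'a set" where
  "blocked r C x = {z \<in> nb x. z \<in> occupied r C \<or> \<not> nb z \<inter> occupied r C \<subseteq> insert x (C z)}"

text \<open>A vertex with \<open>12 + 48 \<Delta>\<close> blocked neighbours must be served at once, while it still has usable
  neighbours. The threshold makes the sparsity count in \<open>card_triggered_le\<close> balance; a single
  service adds at most \<open>5 \<Delta>\<close> blocked neighbours, and \<open>24\<close> interfering and \<open>5 \<Delta>\<close> further ones are
  needed to pick \<open>\<Delta>\<close> independent children, whence the minimum degree \<open>58 \<Delta> + 36\<close>.\<close>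

definition triggered :: "'a \<Rightarrow> ('a \<Rightarrow> 'a set) \<Rightarrow> 'a set" where
  "triggered r C = {x \<in> V. 12 + 48 * \<Delta> \<le> card (blocked r C x)}"

text \<open>The neighbours of \<open>w\<close> that would block a neighbour of another pending vertex in \<open>P\<close> if they became
  children of \<open>w\<close>.\<close>

definition interfering :: "'a set \<Rightarrow> 'a \<Rightarrow> 'a set" where
  "interfering P w = {y \<in> nb w. \<exists>p\<in>P - {w, y}. y \<in> nb p \<or> (\<exists>z. z \<noteq> w \<and> z \<in> nb y \<and> z \<in> nb p)}"

text \<open>The last two conditions say that each edge inside the occupied set joins a vertex to a
  child reserved for it; this is what makes the final embedding induced. The vertex that owns an
  occupied child need not be occupied itself.\<close>

definition valid :: "'a \<Rightarrow> 'a set \<Rightarrow> ('a \<Rightarrow> 'a set) \<Rightarrow> bool" where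
  "valid r S C \<longleftrightarrow> r \<in> V \<and> S \<subseteq> V \<and> (\<forall>w. C w \<subseteq> nb w) \<and> (\<forall>w. w \<notin> S \<longrightarrow> C w = {}) \<and>
     (\<forall>w w'. w \<noteq> w' \<longrightarrow> C w \<inter> C w' = {}) \<and> (\<forall>w. r \<notin> C w) \<and>
     nb r \<inter> occupied r C \<subseteq> C r \<and> (\<forall>w. \<forall>j\<in>C w. nb j \<inter> occupied r C \<subseteq> insert w (C j))"

text \<open>Here \<open>t\<close> bounds the number of occupied vertices that were requested by the tree, and \<open>R\<close> collects
  the vertices served pre-emptively.\<close>

definition inv_state :: "nat \<Rightarrow> 'a \<Rightarrow> 'a set \<Rightarrow> ('a \<Rightarrow> 'a set) \<Rightarrow> bool" where
  "inv_state t r S C \<longleftrightarrow> valid r S C \<and>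
     (\<exists>R \<subseteq> S \<inter> triggered r C. card (occupied r C) \<le> t + \<Delta> * card R) \<and>
     card (triggered r C) \<le> b \<and>
     (\<forall>p\<in>triggered r C - S. card (blocked r C p) \<le> 12 + 53 * \<Delta>)"

lemma validD:
  assumes "valid r S C"
  shows "C w \<subseteq> nb w" "x \<in> C w \<Longrightarrow> x \<in> C w' \<Longrightarrow> w = w'" "r \<notin> C w"
    "y \<in> nb r \<Longrightarrow> y \<in> occupied r C \<Longrightarrow> y \<in> C r"
    "j \<in> C w \<Longrightarrow> y \<in> nb j \<Longrightarrow> y \<in> occupied r C \<Longrightarrow> y = w \<or> y \<in> C j"
proof -
  have a: "\<forall>w. C w \<subseteq> nb w" "\<forall>w w'. w \<noteq> w' \<longrightarrow> C w \<inter> C w' = {}" "\<forall>w. r \<notin> C w"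
    "nb r \<inter> occupied r C \<subseteq> C r" "\<forall>w. \<forall>j\<in>C w. nb j \<inter> occupied r C \<subseteq> insert w (C j)"
    using assms by (simp_all add: valid_def)
  show "C w \<subseteq> nb w" "r \<notin> C w" using a(1,3) by simp_all
  show "w = w'" if "x \<in> C w" "x \<in> C w'" using a(2) that by blast
  show "y \<in> C r" if "y \<in> nb r" "y \<in> occupied r C" using a(4) that by blast
  show "y = w \<or> y \<in> C j" if "j \<in> C w" "y \<in> nb j" "y \<in> occupied r C"
    using bspec[OF spec[OF a(5)] that(1)] that(2,3) by blast
qed

lemma occupied_subset:
  assumes "valid r S C"
  shows "occupied r C \<subseteq> V"
proof -
  have "C w \<subseteq> V" for w using validD(1)[OF assms, of w] nb_subset[of w] by blast
  moreover have "r \<in> V" using assms by (simp add: valid_def)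
  ultimately show ?thesis by (auto simp: occupied_def)
qed

section \<open>The two sparsity counts\<close>

lemma finite_triggered: "finite (triggered r C)"
  using finite_V by (simp add: triggered_def)

text \<open>Let \<open>Q\<close> be the occupied set with b + 1 triggered vertices, and
  \<open>W\<close> their blocked neighbours outside \<open>Q\<close>. A vertex of \<open>W\<close>
  sees a triggered vertex and a different occupied one, so density 3/2 forces |W| \<le> 3 |Q| and a
  degree sum of at most 12 |Q|. Since |Q| < (b + 1) (4 \<Delta> + 1), this is less than the (b + 1)
  (12 + 48 \<Delta>) contributed by the triggered vertices alone.\<close>

lemma card_triggered_le:
  assumes "occupied r C \<subseteq> V" "card (occupied r C) \<le> M + \<Delta> * b"
  shows "card (triggered r C) \<le> b"
proof (rule ccontr)
  assume "\<not> ?thesis"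
  then have "b + 1 \<le> card (triggered r C)" by simp
  then obtain X where X: "X \<subseteq> triggered r C" "card X = b + 1" "finite X"
    by (meson obtain_subset_with_card_n)
  let ?J = "occupied r C"
  have "\<exists>Z\<subseteq>blocked r C x. card Z = 12 + 48 * \<Delta>" if "x \<in> X" for x
  proof -
    have "12 + 48 * \<Delta> \<le> card (blocked r C x)" using that X by (auto simp: triggered_def)
    then show ?thesis by (metis obtain_subset_with_card_n)
  qed
  then obtain Z where Z: "\<And>x. x \<in> X \<Longrightarrow> Z x \<subseteq> blocked r C x" "\<And>x. x \<in> X \<Longrightarrow> card (Z x) = 12 + 48 * \<Delta>"
    by metis
  define Q where "Q = ?J \<union> X"
  define W where "W = (\<Union>x\<in>X. Z x) - Q"
  have fin: "finite ?J" "finite Q" "finite W" "\<And>x. x \<in> X \<Longrightarrow> finite (Z x)"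
  proof -
    show "finite ?J" using assms(1) finite_sub_V by blast
    then show "finite Q" using X by (simp add: Q_def)
    show f: "finite (Z x)" if "x \<in> X" for x
      using Z(1)[OF that] finite_subset[of "Z x" "nb x"] by (auto simp: blocked_def)
    then show "finite W" using X by (auto simp: W_def)
  qed
  have sub: "W \<union> Q \<subseteq> V"
  proof -
    have "Z x \<subseteq> V" if "x \<in> X" for x
      using Z(1)[OF that] nb_subset[of x] by (auto simp: blocked_def)
    moreover have "X \<subseteq> V" using X by (auto simp: triggered_def)
    ultimately show ?thesis using assms(1) by (auto simp: W_def Q_def)
  qed
  have cQ: "card Q \<le> M + \<Delta> * b + b + 1"
    using card_Un_le[of ?J X] assms X by (simp add: Q_def)
  have "card W \<le> card (\<Union>x\<in>X. Z x)"
    unfolding W_def using X fin by (intro card_mono) auto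
  also have "\<dots> \<le> (\<Sum>x\<in>X. card (Z x))" using X by (intro card_UN_le)
  also have "\<dots> = (b + 1) * (12 + 48 * \<Delta>)" using X Z by simp
  finally have "card (W \<union> Q) \<le> u0"
    using card_Un_le[of W Q] cQ u0_ge by (simp add: algebra_simps)
  then have sp: "(\<Sum>x\<in>W \<union> Q. card (nb x \<inter> (W \<union> Q))) \<le> 3 * card (W \<union> Q)"
    using sub by (intro sparse0)
  have cWQ: "card (W \<union> Q) = card W + card Q"
    using fin by (intro card_Un_disjoint) (auto simp: W_def)
  have two: "2 \<le> card (nb w \<inter> Q)" if w: "w \<in> W" for w
  proof -
    obtain x where x: "x \<in> X" "w \<in> Z x" using w by (auto simp: W_def)
    have "w \<notin> ?J" using w by (auto simp: W_def Q_def)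
    then obtain j where "j \<in> nb w" "j \<in> ?J" "j \<noteq> x"
      using Z(1)[OF x(1)] x(2) by (auto simp: blocked_def)
    moreover have "x \<in> nb w" using Z(1)[OF x(1)] x(2) nb_sym by (auto simp: blocked_def)
    ultimately have "{x, j} \<subseteq> nb w \<inter> Q" using x by (auto simp: Q_def)
    then have "card {x, j} \<le> card (nb w \<inter> Q)" by (intro card_mono) auto
    then show ?thesis using \<open>j \<noteq> x\<close> by simp
  qed
  have "4 * card W = (\<Sum>w\<in>W. 4)" by simp
  also have "\<dots> \<le> (\<Sum>w\<in>W. 2 * card (nb w \<inter> Q) + card (nb w \<inter> W))"
    using two by (intro sum_mono) (simp add: trans_le_add1)
  also have "\<dots> \<le> (\<Sum>x\<in>W \<union> Q. card (nb x \<inter> (W \<union> Q)))"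
    using fin by (intro degree_sum_ge) (auto simp: W_def)
  finally have W_le: "4 * card W \<le> (\<Sum>x\<in>W \<union> Q. card (nb x \<inter> (W \<union> Q)))" .
  have "(b + 1) * (12 + 48 * \<Delta>) = (\<Sum>x\<in>X. card (Z x))" using X Z by simp
  also have "\<dots> \<le> (\<Sum>x\<in>X. card (nb x \<inter> (W \<union> Q)))"
  proof (intro sum_mono card_mono)
    show "Z i \<subseteq> nb i \<inter> (W \<union> Q)" if "i \<in> X" for i
      using that Z(1)[OF that] by (auto simp: W_def blocked_def)
  qed auto
  also have "\<dots> \<le> (\<Sum>x\<in>W \<union> Q. card (nb x \<inter> (W \<union> Q)))"
    using fin by (intro sum_mono2) (auto simp: Q_def)
  finally have "(b + 1) * (12 + 48 * \<Delta>) \<le> (\<Sum>x\<in>W \<union> Q. card (nb x \<inter> (W \<union> Q)))" .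
  then have "(b + 1) * (12 + 48 * \<Delta>) \<le> 12 * card Q" using W_le sp cWQ by linarith
  then show False using cQ b_ge Delta_pos by (simp add: algebra_simps)
qed

text \<open>Suppose every pending vertex has 25 interfering neighbours. These and their witnesses
  lie on paths with two or three edges between members of \<open>P\<close>, so each vertex
  \<open>w\<close> outside \<open>P\<close> contributes at least 3 in \<open>degree_sum_ge\<close>,
  against an allowed average of 8/3. This gives |W| \<le> 8 |P|, hence a degree sum of at most 24
  |P|, contradicting 25 |P|.\<close>

lemma exists_few_interfering:
  assumes P: "P \<subseteq> V" "P \<noteq> {}" "card P \<le> b"
  shows "\<exists>p\<in>P. card (interfering P p) \<le> 24"
proof (rule ccontr)
  assume "\<not> ?thesis"
  then have "25 \<le> card (interfering P p)" if "p \<in> P" for p using that by force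
  then have "\<exists>Y\<subseteq>interfering P p. card Y = 25" if "p \<in> P" for p
    using that by (meson obtain_subset_with_card_n)
  then obtain Y where Y: "\<And>p. p \<in> P \<Longrightarrow> Y p \<subseteq> interfering P p" "\<And>p. p \<in> P \<Longrightarrow> card (Y p) = 25"
    by metis
  \<comment> \<open>Setting z = y when \<open>y\<close> is itself adjacent to p' gives one witness
    function for both kinds of interference.\<close>
  have "\<exists>z. \<exists>p'\<in>P - {p, y}. y \<in> nb p' \<and> z = y \<or> (z \<noteq> p \<and> z \<in> nb y \<and> z \<in> nb p')"
    if "p \<in> P" "y \<in> Y p" for p y
  proof -
    have "y \<in> interfering P p" using Y(1)[OF that(1)] that(2) by blast
    then obtain p' where p': "p' \<in> P - {p, y}" "y \<in> nb p' \<or> (\<exists>z. z \<noteq> p \<and> z \<in> nb y \<and> z \<in> nb p')"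
      unfolding interfering_def by blast
    show ?thesis
    proof (cases "y \<in> nb p'")
      case True
      then show ?thesis using p'(1) by (intro exI[of _ y] bexI[of _ p']) auto
    next
      case False
      then show ?thesis using p' by blast
    qed
  qed
  then obtain z where z: "\<And>p y. p \<in> P \<Longrightarrow> y \<in> Y p \<Longrightarrow>
      \<exists>p'\<in>P - {p, y}. y \<in> nb p' \<and> z p y = y \<or> (z p y \<noteq> p \<and> z p y \<in> nb y \<and> z p y \<in> nb p')"
    by metis
  define U where "U = (\<Union>p\<in>P. Y p \<union> z p ` Y p)"
  define W where "W = U - P"
  have finP: "finite P" using P finite_sub_V by blast
  have Ynb: "Y p \<subseteq> nb p" if "p \<in> P" for p using Y(1)[OF that] by (auto simp: interfering_def)
  have finY: "finite (Y p)" if "p \<in> P" for p using Ynb[OF that] by (rule finite_subset) simp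
  have finW: "finite W" using finP finY by (auto simp: W_def U_def)
  have zV: "z p y \<in> V" if "p \<in> P" "y \<in> Y p" for p y
  proof -
    have "y \<in> V" using Ynb[OF that(1)] that(2) nb_subset[of p] by auto
    then show ?thesis using z[OF that] nb_subset[of y] by auto
  qed
  have sub: "W \<union> P \<subseteq> V"
  proof -
    have "Y p \<subseteq> V" if "p \<in> P" for p using Ynb[OF that] nb_subset[of p] by auto
    then show ?thesis using zV P(1) by (auto simp: W_def U_def)
  qed
  have "card W \<le> card U" using finP finY by (auto simp: W_def U_def intro!: card_mono)
  also have "\<dots> \<le> (\<Sum>p\<in>P. card (Y p \<union> z p ` Y p))"
    unfolding U_def using finP by (rule card_UN_le)
  also have "\<dots> \<le> (\<Sum>p\<in>P. 50)"
  proof (intro sum_mono)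
    fix p assume p: "p \<in> P"
    show "card (Y p \<union> z p ` Y p) \<le> 50"
      using card_Un_le[of "Y p" "z p ` Y p"] card_image_le[OF finY[OF p], of "z p"] Y(2)[OF p] by simp
  qed
  finally have "card W \<le> 50 * card P" by simp
  moreover have cWP: "card (W \<union> P) = card W + card P"
    using finP finW by (intro card_Un_disjoint) (auto simp: W_def)
  ultimately have sp: "3 * (\<Sum>x\<in>W \<union> P. card (nb x \<inter> (W \<union> P))) \<le> 8 * card (W \<union> P)"
    using sub P u1_ge by (intro sparse1) auto
  have pair: "2 \<le> card (nb w \<inter> P)" if "p \<in> P" "q \<in> P" "p \<noteq> q" "w \<in> nb p" "w \<in> nb q" for w p q
  proof -
    have "card {p, q} \<le> card (nb w \<inter> P)"
      using that finP nb_sym by (intro card_mono) auto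
    then show ?thesis using that by simp
  qed
  have single: "1 \<le> card (nb w \<inter> A)" if "x \<in> A" "w \<in> nb x" for w x A
  proof -
    have "x \<in> nb w \<inter> A" using that nb_sym by auto
    then show ?thesis by (metis One_nat_def Suc_leI card_gt_0_iff empty_iff finite_Int finite_nb)
  qed
  \<comment> \<open>\<open>w\<close> is an inner vertex of a path p, y, p' or p, y, z, p'. Its two
    path neighbours are both in \<open>P\<close>, contributing 4, or one is in \<open>P\<close> and
    one in \<open>W\<close>, contributing 3.\<close>
  have three: "3 \<le> 2 * card (nb w \<inter> P) + card (nb w \<inter> W)" if w: "w \<in> W" for w
  proof -
    obtain p y where py: "p \<in> P" "y \<in> Y p" "w = y \<or> w = z p y" using w by (auto simp: W_def U_def)
    obtain p' where p': "p' \<in> P" "p' \<noteq> p" "p' \<noteq> y"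
      "y \<in> nb p' \<and> z p y = y \<or> (z p y \<noteq> p \<and> z p y \<in> nb y \<and> z p y \<in> nb p')"
      using z[OF py(1,2)] by auto
    have yp: "y \<in> nb p" using Ynb py by auto
    have UW: "y \<in> P \<union> W" "z p y \<in> P \<union> W" using py by (auto simp: W_def U_def)
    show ?thesis
    proof (cases "y \<in> nb p' \<and> z p y = y")
      case True
      then show ?thesis using pair[OF py(1) p'(1), of w] py p' yp by auto
    next
      case False
      then have zz: "z p y \<noteq> p" "z p y \<in> nb y" "z p y \<in> nb p'" using p'(4) by auto
      show ?thesis
      proof (cases "w = y")
        case True
        show ?thesis
        proof (cases "z p y \<in> P")
          case True
          have "2 \<le> card (nb w \<inter> P)"
            by (rule pair[OF py(1) True]) (use zz yp \<open>w = y\<close> nb_sym in auto)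
          then show ?thesis by simp
        next
          case False
          then have "1 \<le> card (nb w \<inter> W)" using UW(2) zz nb_sym \<open>w = y\<close> by (intro single[of "z p y"]) auto
          moreover have "1 \<le> card (nb w \<inter> P)" using py yp \<open>w = y\<close> by (intro single[of p]) auto
          ultimately show ?thesis by simp
        qed
      next
        case False
        then have wz: "w = z p y" using py by auto
        show ?thesis
        proof (cases "y \<in> P")
          case True
          have "2 \<le> card (nb w \<inter> P)"
            by (rule pair[OF True p'(1)]) (use zz wz p' in auto)
          then show ?thesis by simp
        next
          case False
          then have "1 \<le> card (nb w \<inter> W)" using UW(1) zz wz by (intro single[of y]) auto
          moreover have "1 \<le> card (nb w \<inter> P)" using p' zz wz by (intro single[of p']) auto
          ultimately show ?thesis by simp
        qed
      qed
    qed
  qed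
  have "3 * card W = (\<Sum>w\<in>W. 3)" by simp
  also have "\<dots> \<le> (\<Sum>w\<in>W. 2 * card (nb w \<inter> P) + card (nb w \<inter> W))"
    using three by (intro sum_mono)
  also have "\<dots> \<le> (\<Sum>x\<in>W \<union> P. card (nb x \<inter> (W \<union> P)))"
    using finW finP by (intro degree_sum_ge) (auto simp: W_def)
  finally have W_le: "3 * card W \<le> (\<Sum>x\<in>W \<union> P. card (nb x \<inter> (W \<union> P)))" .
  have "25 * card P = (\<Sum>p\<in>P. card (Y p))" using Y by simp
  also have "\<dots> \<le> (\<Sum>p\<in>P. card (nb p \<inter> (W \<union> P)))"
  proof (intro sum_mono card_mono)
    show "Y i \<subseteq> nb i \<inter> (W \<union> P)" if "i \<in> P" for i
      using that Ynb[OF that] by (auto simp: W_def U_def)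
  qed auto
  also have "\<dots> \<le> (\<Sum>x\<in>W \<union> P. card (nb x \<inter> (W \<union> P)))"
    using finW finP by (intro sum_mono2) auto
  finally have "25 * card P \<le> (\<Sum>x\<in>W \<union> P. card (nb x \<inter> (W \<union> P)))" .
  then have "card P = 0" using W_le sp cWP by linarith
  then show False using P finP by simp
qed

section \<open>The effect of serving one vertex\<close>

lemma occupied_upd: "C w = {} \<Longrightarrow> occupied r (C(w := Y)) = occupied r C \<union> Y"
  by (auto simp: occupied_def split: if_splits)

text \<open>An edge from a new child \<open>y\<close> to the old occupied set ends in
  \<open>w\<close> or in \<open>C y\<close>, because \<open>y\<close> is not blocked; independence
  of \<open>Y\<close> excludes the remaining new edges. The case \<open>C y\<close> is a vertex
  served early that now joins its own waiting children.\<close>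

lemma valid_upd:
  assumes v: "valid r S C" and w: "w \<in> V" "w \<notin> S"
    and Y: "Y \<subseteq> nb w - blocked r C w" "\<And>y. y \<in> Y \<Longrightarrow> nb y \<inter> Y = {}"
  shows "valid r (insert w S) (C(w := Y))"
proof -
  let ?C = "C(w := Y)"
  have Cw: "C w = {}" using v w by (simp add: valid_def)
  have occupied': "occupied r ?C = occupied r C \<union> Y" by (rule occupied_upd[of C w, OF Cw])
  have Yn: "y \<in> nb w" "y \<notin> occupied r C" "nb y \<inter> occupied r C \<subseteq> insert w (C y)" if "y \<in> Y" for y
    using Y(1) that by (auto simp: blocked_def)
  have Cocc: "C x \<subseteq> occupied r C" "r \<in> occupied r C" for x by (auto simp: occupied_def)
  have sub: "C x \<subseteq> ?C x" for x using Cw by auto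
  have disj: "C x \<inter> C y = {}" if "x \<noteq> y" for x y using v that by (auto simp: valid_def)
  have adj: "nb j \<inter> Y \<subseteq> insert w' (?C j)" if j: "j \<in> occupied r C" and own: "\<And>x. j \<in> C x \<Longrightarrow> x = w'" for j w'
  proof
    fix y assume y: "y \<in> nb j \<inter> Y"
    then have "j \<in> insert w (C y)" using Yn(3)[of y] j nb_sym by auto
    then show "y \<in> insert w' (?C j)" using own y by auto
  qed
  show ?thesis
    unfolding valid_def
  proof (intro conjI allI impI ballI)
    show "r \<in> V" "insert w S \<subseteq> V" using v w by (auto simp: valid_def)
    show "?C x \<subseteq> nb x" for x using v Yn by (auto simp: valid_def)
    show "?C x = {}" if "x \<notin> insert w S" for x using that v by (auto simp: valid_def)
    show "?C x \<inter> ?C y = {}" if "x \<noteq> y" for x y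
      using that disj[OF that] Yn(2) Cocc by (auto split: if_splits)
    show "r \<notin> ?C x" for x using v Yn Cocc by (auto simp: valid_def)
    show "nb r \<inter> occupied r ?C \<subseteq> ?C r"
    proof
      fix y assume y: "y \<in> nb r \<inter> occupied r ?C"
      show "y \<in> ?C r"
      proof (cases "y \<in> Y")
        case True
        then have "r \<in> insert w (C y)" using Yn(3)[of y] y nb_sym Cocc by auto
        then show ?thesis using v True by (auto simp: valid_def)
      next
        case False
        then have "y \<in> C r" using y v by (auto simp: valid_def occupied')
        then show ?thesis using sub by blast
      qed
    qed
    show "nb j \<inter> occupied r ?C \<subseteq> insert x (?C j)" if j: "j \<in> ?C x" for x j
    proof (cases "x = w")
      case True
      then have "j \<in> Y" "j \<noteq> w" using j Yn(1) nb_irrefl by auto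
      then show ?thesis using Yn(3) Y(2) True sub[of j] by (auto simp: occupied')
    next
      case False
      then have jC: "j \<in> C x" using j by simp
      have "nb j \<inter> occupied r C \<subseteq> insert x (C j)" using v jC by (auto simp: valid_def)
      moreover have "nb j \<inter> Y \<subseteq> insert x (?C j)"
        using jC disj Cocc by (intro adj) blast+
      ultimately show ?thesis using sub[of j] by (auto simp: occupied')
    qed
  qed
qed

lemma blocked_upd_mono:
  assumes Cw: "C w = {}" and Y: "Y \<inter> occupied r C = {}"
  shows "blocked r C x \<subseteq> blocked r (C(w := Y)) x"
  using Y by (auto simp: blocked_def occupied_upd[of C w, OF Cw])

text \<open>A new child \<open>y\<close> can block for \<open>x\<close> only itself and common
  neighbours of \<open>x\<close> and \<open>y\<close>. Two exemptions in \<open>blocked\<close>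
  explain the exceptions: y = x does not count against neighbours of \<open>x\<close>, and
  \<open>y\<close> does not count against its owner \<open>w\<close>.\<close>

lemma blocked_upd_new:
  assumes Cw: "C w = {}"
  shows "blocked r (C(w := Y)) x \<subseteq> blocked r C x \<union>
     (\<Union>y\<in>Y - {x}. {z \<in> nb x. z = y \<or> z \<noteq> w \<and> z \<in> nb y})"
proof
  fix z assume z: "z \<in> blocked r (C(w := Y)) x"
  show "z \<in> blocked r C x \<union> (\<Union>y\<in>Y - {x}. {z \<in> nb x. z = y \<or> z \<noteq> w \<and> z \<in> nb y})"
  proof (cases "z \<in> blocked r C x")
    case False
    have zx: "z \<in> nb x" "z \<noteq> x" using z nb_irrefl by (auto simp: blocked_def)
    have old: "z \<notin> occupied r C" "nb z \<inter> occupied r C \<subseteq> insert x (C z)" using False zx by (auto simp: blocked_def)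
    show ?thesis
    proof (cases "z \<in> Y")
      case True
      then show ?thesis using zx by auto
    next
      case False
      then obtain j where j: "j \<in> nb z" "j \<in> occupied r C \<union> Y" "j \<noteq> x" "j \<notin> (C(w := Y)) z"
        using z old(1) unfolding blocked_def occupied_upd[of C w, OF Cw] by blast
      then have "j \<in> Y" "z \<noteq> w" using old(2) Cw by (auto split: if_splits)
      then show ?thesis using j nb_sym zx by auto
    qed
  qed simp
qed

lemma finite_blocked [simp]: "finite (blocked r C x)"
  by (simp add: blocked_def)

lemma card_blocked_upd:
  assumes Cw: "C w = {}" and Y: "finite Y" "card Y \<le> \<Delta>"
  shows "card (blocked r (C(w := Y)) x) \<le> card (blocked r C x) + 5 * \<Delta>"
proof -
  let ?B = "\<lambda>y. {z \<in> nb x. z = y \<or> z \<noteq> w \<and> z \<in> nb y}"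
  have "card (?B y) \<le> 5" if "y \<in> Y - {x}" for y
  proof -
    have "card (?B y) \<le> card (insert y (nb x \<inter> nb y))" by (intro card_mono) auto
    also have "\<dots> \<le> 5" using codegree_le[of x y] that by (auto simp: card_insert_if)
    finally show ?thesis .
  qed
  then have "(\<Sum>y\<in>Y - {x}. card (?B y)) \<le> (\<Sum>y\<in>Y - {x}. 5)" by (intro sum_mono)
  also have "\<dots> \<le> 5 * \<Delta>" using Y card_Diff1_le[of Y x] by (simp add: mult.commute)
  finally have "card (\<Union>y\<in>Y - {x}. ?B y) \<le> 5 * \<Delta>"
    using card_UN_le[of "Y - {x}" ?B] Y by simp
  moreover have "card (blocked r (C(w := Y)) x) \<le> card (blocked r C x \<union> (\<Union>y\<in>Y - {x}. ?B y))"
    using blocked_upd_new[where C=C, OF Cw] Y by (intro card_mono) auto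
  ultimately show ?thesis using card_Un_le[of "blocked r C x" "\<Union>y\<in>Y - {x}. ?B y"] by simp
qed

text \<open>The \<open>k\<close> new children are charged to \<open>w\<close> itself if it is
  triggered, and to the request counter otherwise. Avoiding blocked and interfering neighbours
  leaves at least 5 \<Delta> candidates.\<close>

lemma serve:
  assumes inv_state: "inv_state t r S C" and t: "t' \<le> M"
    and w: "w \<in> V" "w \<notin> S"
    and blk: "card (blocked r C w) \<le> 12 + 53 * \<Delta>"
    and bd: "card (interfering (triggered r C - S) w) \<le> 24"
    and k: "k \<le> \<Delta>"
    and t': "if w \<in> triggered r C then t' = t else t' = t + k"
  shows "\<exists>Y. card Y = k \<and> inv_state t' r (insert w S) (C(w := Y))"
proof -
  let ?P = "triggered r C - S"
  have v: "valid r S C" using inv_state by (simp add: inv_state_def)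
  then have Cw: "C w = {}" using w by (simp add: valid_def)
  let ?A = "nb w - (blocked r C w \<union> interfering ?P w)"
  have "card (blocked r C w \<union> interfering ?P w) \<le> 36 + 53 * \<Delta>"
    using card_Un_le[of "blocked r C w" "interfering ?P w"] blk bd by simp
  moreover have "card (nb w) - card (blocked r C w \<union> interfering ?P w) \<le> card ?A"
    by (intro diff_card_le_card_Diff) (simp add: interfering_def)
  ultimately have "5 * k \<le> card ?A" using min_degree[OF w(1)] k by linarith
  moreover have "card (nb y \<inter> ?A) \<le> 4" if "y \<in> ?A" for y
  proof -
    have "y \<noteq> w" using that nb_irrefl by auto
    have "card (nb y \<inter> ?A) \<le> card (nb y \<inter> nb w)" by (intro card_mono) auto
    also have "\<dots> \<le> 4" using codegree_le[OF \<open>y \<noteq> w\<close>] .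
    finally show ?thesis .
  qed
  ultimately obtain Y where Y: "Y \<subseteq> ?A" "card Y = k" "\<forall>y\<in>Y. nb y \<inter> Y = {}"
    using independent_subset[of ?A k] by auto
  let ?C = "C(w := Y)"
  have finY: "finite Y" using Y(1) by (rule finite_subset) simp
  have v': "valid r (insert w S) ?C" using v w Y by (intro valid_upd) auto
  have YJ: "Y \<inter> occupied r C = {}" using Y(1) by (auto simp: blocked_def)
  have mono: "blocked r C x \<subseteq> blocked r ?C x" for x by (rule blocked_upd_mono[where C=C, OF Cw YJ])
  then have "card (blocked r C x) \<le> card (blocked r ?C x)" for x by (intro card_mono) auto
  then have tmono: "triggered r C \<subseteq> triggered r ?C"
    unfolding triggered_def using order_trans by blast
  obtain R where R: "R \<subseteq> S \<inter> triggered r C" "card (occupied r C) \<le> t + \<Delta> * card R"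
    using inv_state by (auto simp: inv_state_def)
  have finR: "finite R" using R finite_triggered[of r C] finite_subset by blast
  have cocc: "card (occupied r ?C) \<le> card (occupied r C) + k"
    using card_Un_le[of "occupied r C" Y] Y(2) by (simp add: occupied_upd[of C w, OF Cw])
  \<comment> \<open>The bound on the occupied set depends on the number of triggered vertices and
    conversely. Charging to vertices triggered in the old state, of which there are at most
    \<open>b\<close>, breaks the circle; \<open>card_triggered_le\<close> then bounds the new
    triggered set.\<close>
  obtain R' where R': "R' \<subseteq> insert w S \<inter> triggered r C" "card (occupied r ?C) \<le> t' + \<Delta> * card R'"
  proof (cases "w \<in> triggered r C")
    case True
    have "card (insert w R) = card R + 1" using finR R w by (subst card_insert_disjoint) auto
    then have "card (occupied r ?C) \<le> t' + \<Delta> * card (insert w R)" using R cocc k t' True by auto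
    then show ?thesis using that[of "insert w R"] R True by auto
  next
    case False
    then show ?thesis using that[of R] R cocc t' by auto
  qed
  have "card R' \<le> b"
    using R' card_mono[OF finite_triggered[of r C], of R'] inv_state by (auto simp: inv_state_def)
  then have "card (occupied r ?C) \<le> M + \<Delta> * b"
    using R'(2) t mult_le_mono2[of "card R'" b \<Delta>] by linarith
  then have tb: "card (triggered r ?C) \<le> b"
    by (intro card_triggered_le occupied_subset[OF v'])
  have pend: "card (blocked r ?C p) \<le> 12 + 53 * \<Delta>" if p: "p \<in> triggered r ?C - insert w S" for p
  proof (cases "p \<in> triggered r C")
    case True
    then have pP: "p \<in> ?P" "p \<noteq> w" using p by auto
    have "(\<Union>y\<in>Y - {p}. {z \<in> nb p. z = y \<or> z \<noteq> w \<and> z \<in> nb y}) = {}"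
    proof (rule ccontr)
      assume "\<not> ?thesis"
      then obtain y z where yz: "y \<in> Y" "y \<noteq> p" "z \<in> nb p" "z = y \<or> z \<noteq> w \<and> z \<in> nb y" by auto
      then have "y \<in> interfering ?P w" using pP Y(1) by (auto simp: interfering_def)
      then show False using yz Y(1) by auto
    qed
    then have "blocked r ?C p \<subseteq> blocked r C p"
      using blocked_upd_new[where C=C, OF Cw, of r Y p] by (simp only: Un_empty_right)
    then have "card (blocked r ?C p) \<le> card (blocked r C p)" by (intro card_mono) auto
    then show ?thesis using inv_state pP by (auto simp: inv_state_def intro: order_trans)
  next
    case False
    then have "card (blocked r C p) < 12 + 48 * \<Delta>" using p by (auto simp: triggered_def)
    then show ?thesis using card_blocked_upd[where C=C, OF Cw finY, of r p] Y(2) k by linarith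
  qed
  have "inv_state t' r (insert w S) ?C"
    unfolding inv_state_def using v' R' tmono tb pend by blast
  then show ?thesis using Y(2) by blast
qed

text \<open>Serving the pending vertex with few interfering neighbours leaves all other pending vertices exactly
  as blocked as before, so the cascade of newly triggered vertices never exhausts one of them.\<close>

lemma clear_pending:
  assumes "inv_state t r S C" "t \<le> M"
  shows "\<exists>S' C'. inv_state t r S' C' \<and> triggered r C' \<subseteq> S' \<and> S \<subseteq> S' \<and> (\<forall>w\<in>S. C' w = C w) \<and>
           (\<forall>w\<in>S' - S. card (C' w) = \<Delta>)"
  using assms
proof (induction "card (V - S)" arbitrary: S C rule: less_induct)
  case less
  let ?P = "triggered r C - S"
  show ?case
  proof (cases "?P = {}")
    case True
    then show ?thesis using less.prems by blast
  next
    case False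
    have "card ?P \<le> card (triggered r C)" by (intro card_mono finite_triggered) auto
    then have "card ?P \<le> b" using less.prems by (auto simp: inv_state_def)
    then obtain p where p: "p \<in> ?P" "card (interfering ?P p) \<le> 24"
      using exists_few_interfering[of ?P] False by (auto simp: triggered_def)
    have pV: "p \<in> V" "p \<notin> S" using p by (auto simp: triggered_def)
    have "card (blocked r C p) \<le> 12 + 53 * \<Delta>" using less.prems p by (auto simp: inv_state_def)
    then obtain Y where Y: "card Y = \<Delta>" "inv_state t r (insert p S) (C(p := Y))"
      using serve[OF less.prems pV _ p(2), of \<Delta>] p by auto
    have "card (V - insert p S) < card (V - S)"
      using pV finite_V by (intro psubset_card_mono) auto
    from less.hyps[OF this Y(2) less.prems(2)] obtain S' C' where
      *: "inv_state t r S' C'" "triggered r C' \<subseteq> S'" "insert p S \<subseteq> S'"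
      "\<forall>w\<in>insert p S. C' w = (C(p := Y)) w" "\<forall>w\<in>S' - insert p S. card (C' w) = \<Delta>" by blast
    have "\<forall>w\<in>S. C' w = C w" using *(4) pV by auto
    moreover have "\<forall>w\<in>S' - S. card (C' w) = \<Delta>" using * Y by fastforce
    ultimately show ?thesis using * by blast
  qed
qed

text \<open>A vertex served in advance answers with the children it already holds; the counter,
  being an upper bound, may simply grow. Otherwise nothing is pending, so no neighbour interferes,
  and the cascade after the service is cleared. The last conclusion keeps \<Delta> children ready at
  every vertex served in that cascade.\<close>

lemma request:
  assumes inv_state: "inv_state t r S C" "triggered r C \<subseteq> S" and t: "t + k \<le> M" and k: "k \<le> \<Delta>"
    and w: "w \<in> V"
    and full: "w \<in> S \<longrightarrow> k \<le> card (C w)"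
  shows "\<exists>S' C'. inv_state (t + k) r S' C' \<and> triggered r C' \<subseteq> S' \<and> insert w S \<subseteq> S' \<and>
           (\<forall>x\<in>S. C' x = C x) \<and> k \<le> card (C' w) \<and> (\<forall>x\<in>S' - insert w S. card (C' x) = \<Delta>)"
proof (cases "w \<in> S")
  case True
  obtain R where R: "R \<subseteq> S \<inter> triggered r C" "card (occupied r C) \<le> t + \<Delta> * card R"
    using inv_state(1) by (auto simp: inv_state_def)
  then have "card (occupied r C) \<le> t + k + \<Delta> * card R" by simp
  then have "inv_state (t + k) r S C" using inv_state(1) R(1) unfolding inv_state_def by blast
  then show ?thesis using inv_state True full by blast
next
  case False
  then have nt: "w \<notin> triggered r C" using inv_state by auto
  then have "card (blocked r C w) \<le> 12 + 53 * \<Delta>" using w by (auto simp: triggered_def)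
  moreover have "interfering (triggered r C - S) w = {}" using inv_state by (auto simp: interfering_def)
  ultimately obtain Y where Y: "card Y = k" "inv_state (t + k) r (insert w S) (C(w := Y))"
    using serve[OF inv_state(1) t w False _ _ k] nt by auto
  from clear_pending[OF Y(2) t] obtain S' C' where
    *: "inv_state (t + k) r S' C'" "triggered r C' \<subseteq> S'" "insert w S \<subseteq> S'"
      "\<forall>x\<in>insert w S. C' x = (C(w := Y)) x" "\<forall>x\<in>S' - insert w S. card (C' x) = \<Delta>" by blast
  have "\<forall>x\<in>S. C' x = C x" "k \<le> card (C' w)" using *(4) False Y by auto
  then show ?thesis using * by blast
qed

section \<open>Embedding a tree given by its parent function\<close>

lemma inv_state_initial:
  assumes "r \<in> V" "M \<ge> 1"
  shows "inv_state 1 r {} (\<lambda>_. {})" "triggered r (\<lambda>_. {}) = {}"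
proof -
  have o: "occupied r (\<lambda>_. {}) = {r}" by (simp add: occupied_def)
  have "card (blocked r (\<lambda>_. {}) x) \<le> 5" for x
  proof (cases "x = r")
    case True
    then have "blocked r (\<lambda>_. {}) x = {}" using nb_irrefl by (auto simp: blocked_def o)
    then show ?thesis by simp
  next
    case False
    have "card (blocked r (\<lambda>_. {}) x) \<le> card (insert r (nb x \<inter> nb r))"
      using nb_sym by (intro card_mono) (auto simp: blocked_def o)
    also have "\<dots> \<le> 5" using codegree_le[OF False] by (simp add: card_insert_if)
    finally show ?thesis .
  qed
  then show t: "triggered r (\<lambda>_. {}) = {}" 
    by (simp add: triggered_def not_le le_less_trans[of _ 5])
  show "inv_state 1 r {} (\<lambda>_. {})"
    using assms nb_irrefl by (auto simp: inv_state_def valid_def t o)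
qed

lemma embed_parent_tree:
  assumes V: "V \<noteq> {}" and m: "1 \<le> m" "m \<le> M"
    and par: "\<And>i. 1 \<le> i \<Longrightarrow> i < m \<Longrightarrow> p i < i"
    and deg: "\<And>j. j < m \<Longrightarrow> card {i \<in> {1..<m}. p i = j} \<le> \<Delta>"
  shows "\<exists>f. inj_on f {0..<m} \<and> f ` {0..<m} \<subseteq> V \<and>
    (\<forall>i<m. \<forall>j<m. i \<noteq> j \<longrightarrow> (f j \<in> nb (f i) \<longleftrightarrow> (1 \<le> j \<and> p j = i) \<or> (1 \<le> i \<and> p i = j)))"
proof -
  define ch where "ch j = {i \<in> {1..<m}. p i = j}" for j
  define D where "D j = insert 0 (\<Union>i<j. ch i)" for j
  obtain r where r: "r \<in> V" using V by auto
  have fch: "finite (ch j)" for j by (simp add: ch_def)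
  \<comment> \<open>\<open>D j\<close> consists of the tree vertices placed once those below
    \<open>j\<close> have received their children. The last clause makes reservations reusable: a
    served vertex carrying no processed tree vertex still has \<Delta> children for one that is
    placed there.\<close>
  have "\<exists>S C f. inv_state (1 + (\<Sum>i<j. card (ch i))) r S C \<and> triggered r C \<subseteq> S \<and> f 0 = r \<and> inj_on f (D j) \<and>
      (\<forall>i<j. f i \<in> S \<and> f ` ch i \<subseteq> C (f i)) \<and>
      (\<forall>x\<in>S. x \<notin> f ` {..<j} \<longrightarrow> card (C x) = \<Delta>)" if "j \<le> m" for j
    using that
  proof (induction j)
    case 0
    show ?case
      using inv_state_initial[OF r] m by (intro exI[of _ "{}"] exI[of _ "\<lambda>_. {}"] exI[of _ "\<lambda>_. r"]) (auto simp: D_def)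
  next
    case (Suc j)
    then obtain S C f where IH: "inv_state (1 + (\<Sum>i<j. card (ch i))) r S C" "triggered r C \<subseteq> S" "f 0 = r"
      "inj_on f (D j)" "\<And>i. i < j \<Longrightarrow> f i \<in> S" "\<And>i. i < j \<Longrightarrow> f ` ch i \<subseteq> C (f i)"
      "\<And>x. x \<in> S \<Longrightarrow> x \<notin> f ` {..<j} \<Longrightarrow> card (C x) = \<Delta>" by (auto simp: image_subset_iff)
    have jm: "j < m" using Suc by simp
    have "{..<j} \<subseteq> D j" "j \<in> D j"
    proof -
      have "i \<in> D j" if "i \<le> j" for i
        using that jm par[of i] by (cases "i = 0") (auto simp: D_def ch_def)
      then show "{..<j} \<subseteq> D j" "j \<in> D j" by auto
    qed
    have jnot: "f j \<notin> f ` {..<j}"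
      using IH(4) \<open>{..<j} \<subseteq> D j\<close> \<open>j \<in> D j\<close> inj_on_image_mem_iff[of f "D j" j "{..<j}"] by auto
    have disj_ch: "ch i \<inter> ch i' = {}" if "i \<noteq> i'" for i i' using that by (auto simp: ch_def)
    have "1 + (\<Sum>i<Suc j. card (ch i)) = 1 + card (\<Union>i<Suc j. ch i)"
      using fch disj_ch by (subst card_UN_disjoint) auto
    also have "\<dots> \<le> 1 + card {1..<m}"
      by (intro add_left_mono card_mono) (auto simp: ch_def)
    also have "\<dots> \<le> M" using m by simp
    finally have tM: "1 + (\<Sum>i<j. card (ch i)) + card (ch j) \<le> M" by simp
    have valid: "valid r S C" using IH(1) by (simp add: inv_state_def)
    have Docc: "f ` D j \<subseteq> occupied r C" using IH(3,6) by (fastforce simp: D_def occupied_def)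
    then have fV: "f j \<in> V" using \<open>j \<in> D j\<close> occupied_subset[OF valid] by auto
    have kD: "card (ch j) \<le> \<Delta>" using deg[OF jm] by (simp add: ch_def)
    obtain S' C' where *: "inv_state (1 + (\<Sum>i<j. card (ch i)) + card (ch j)) r S' C'" "triggered r C' \<subseteq> S'"
      "insert (f j) S \<subseteq> S'" "\<And>x. x \<in> S \<Longrightarrow> C' x = C x" "card (ch j) \<le> card (C' (f j))"
      "\<And>x. x \<in> S' - insert (f j) S \<Longrightarrow> card (C' x) = \<Delta>"
    proof -
      have "f j \<in> S \<longrightarrow> card (ch j) \<le> card (C (f j))" using IH(7)[OF _ jnot] kD by simp
      from request[OF IH(1,2) tM kD fV this] obtain S' C' where
        "inv_state (1 + (\<Sum>i<j. card (ch i)) + card (ch j)) r S' C' \<and> triggered r C' \<subseteq> S' \<and>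
         insert (f j) S \<subseteq> S' \<and> (\<forall>x\<in>S. C' x = C x) \<and> card (ch j) \<le> card (C' (f j)) \<and>
         (\<forall>x\<in>S' - insert (f j) S. card (C' x) = \<Delta>)"
        by (elim exE)
      then show ?thesis by (intro that[of S' C']) auto
    qed
    have valid': "valid r S' C'" using *(1) by (simp add: inv_state_def)
    have finC: "finite (C' (f j))" using validD(1)[OF valid'] by (rule finite_subset) simp
    obtain g where g: "inj_on g (ch j)" "g ` ch j \<subseteq> C' (f j)"
      using card_le_inj[OF fch finC *(5)] by auto
    define h where "h x = (if x \<in> ch j then g x else f x)" for x
    have Dch: "D j \<inter> ch j = {}" by (auto simp: D_def ch_def)
    have hf: "h x = f x" if "x \<in> D j" for x using that Dch by (auto simp: h_def)
    have hj: "h i = f i" if "i \<le> j" for i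
      using that by (intro hf) (use \<open>{..<j} \<subseteq> D j\<close> \<open>j \<in> D j\<close> in \<open>cases "i = j"\<close>, auto)
    have him: "h ` ch i = f ` ch i" if "i < j" for i
      using that disj_ch[of i j] by (intro image_cong) (auto simp: h_def)
    have hchj: "h ` ch j = g ` ch j" by (intro image_cong) (auto simp: h_def)
    \<comment> \<open>A placed vertex other than the root lies in the child set of some
      \<open>f i\<close> with i < j, and child sets of different vertices are disjoint; so no child
      of \<open>f j\<close> carries a tree vertex yet.\<close>
    have disjC: "f ` D j \<inter> C' (f j) = {}"
    proof (rule ccontr)
      assume "\<not> ?thesis"
      then obtain x where x: "x \<in> D j" "f x \<in> C' (f j)" by auto
      then have "x \<noteq> 0" using IH(3) validD(3)[OF valid'] by metis
      then obtain i where i: "i < j" "x \<in> ch i" using x by (auto simp: D_def)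
      then have "f x \<in> C' (f i)" using IH(5,6) *(4) by (auto simp: image_subset_iff)
      moreover have "f i \<noteq> f j" using jnot i by (metis imageI lessThan_iff)
      ultimately show False using x validD(2)[OF valid'] by blast
    qed
    have DS: "D (Suc j) = D j \<union> ch j" by (auto simp: D_def lessThan_Suc)
    have "inj_on h (D (Suc j))"
      unfolding DS inj_on_Un
    proof (intro conjI)
      show "inj_on h (D j)" using IH(4) hf by (simp add: inj_on_def)
      show "inj_on h (ch j)" using g(1) by (simp add: inj_on_def h_def)
      show "h ` (D j - ch j) \<inter> h ` (ch j - D j) = {}"
        using disjC g(2) hchj hf by (auto simp: image_subset_iff h_def)
    qed
    moreover have "h i \<in> S' \<and> h ` ch i \<subseteq> C' (h i)" if "i < Suc j" for i
    proof (cases "i = j")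
      case True
      then show ?thesis using hj[of j] hchj g(2) *(3) by auto
    next
      case False
      then have "i < j" using that by simp
      then show ?thesis using hj[of i] him[of i] IH(5)[of i] IH(6)[of i] *(3,4) by auto
    qed
    moreover have "card (C' x) = \<Delta>" if x: "x \<in> S'" "x \<notin> h ` {..<Suc j}" for x
    proof -
      have "h ` {..<Suc j} = f ` {..<Suc j}" using hj by (intro image_cong) auto
      then have "x \<noteq> f j" "x \<notin> f ` {..<j}" using x by (auto simp: lessThan_Suc)
      then show ?thesis using x * IH(7) by (cases "x \<in> S") auto
    qed
    moreover have "h 0 = r" using hj[of 0] IH(3) by simp
    ultimately show ?case using *(1,2)
      by (intro exI[of _ S'] exI[of _ C'] exI[of _ h]) (auto simp: add.assoc)
  qed
  from this[of m] obtain S C f where F: "inv_state (1 + (\<Sum>i<m. card (ch i))) r S C" "f 0 = r"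
      "inj_on f (D m)" "\<And>i. i < m \<Longrightarrow> f ` ch i \<subseteq> C (f i)" by auto
  have v: "valid r S C" using F(1) by (simp add: inv_state_def)
  have Dm: "D m = {0..<m}"
  proof
    show "D m \<subseteq> {0..<m}" using m by (auto simp: D_def ch_def)
    show "{0..<m} \<subseteq> D m"
    proof
      fix i assume "i \<in> {0..<m}"
      then show "i \<in> D m" using par[of i] by (cases "i = 0") (auto simp: D_def ch_def)
    qed
  qed
  have child: "f i \<in> C (f (p i))" if "1 \<le> i" "i < m" for i
    using F(4)[of "p i"] par[OF that] that by (auto simp: ch_def image_subset_iff)
  have focc: "f i \<in> occupied r C" if "i < m" for i
    using that child[of i] F(2) by (cases "i = 0") (auto simp: occupied_def)
  have finj: "i = j" if "f i = f j" "i < m" "j < m" for i j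
    using F(3) that by (auto simp: Dm inj_on_def)
  have own: "1 \<le> j \<and> p j = i" if "f j \<in> C (f i)" "i < m" "j < m" for i j
  proof -
    have "j \<noteq> 0" using that F(2) validD(3)[OF v] by metis
    then have "f j \<in> C (f (p j))" "p j < m" using child[of j] par[of j] that by auto
    then have "f (p j) = f i" using that validD(2)[OF v] by blast
    then show ?thesis using finj \<open>p j < m\<close> that \<open>j \<noteq> 0\<close> by auto
  qed
  \<comment> \<open>The image lies in the occupied set, so validity admits only edges from parent to
    child; surplus reserved vertices stay outside the image.\<close>
  have "f j \<in> nb (f i) \<longleftrightarrow> (1 \<le> j \<and> p j = i) \<or> (1 \<le> i \<and> p i = j)" if ij: "i < m" "j < m" "i \<noteq> j" for i j
  proof
    assume "(1 \<le> j \<and> p j = i) \<or> (1 \<le> i \<and> p i = j)"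
    then show "f j \<in> nb (f i)"
      using child[of i] child[of j] ij validD(1)[OF v] nb_sym by blast
  next
    assume a: "f j \<in> nb (f i)"
    show "(1 \<le> j \<and> p j = i) \<or> (1 \<le> i \<and> p i = j)"
    proof (cases "i = 0")
      case True
      then have "f j \<in> C (f i)" using a F(2) validD(4)[OF v _ focc[OF ij(2)]] by auto
      then show ?thesis using own ij by auto
    next
      case False
      then have "f i \<in> C (f (p i))" using child[of i] ij by auto
      then have "f j = f (p i) \<or> f j \<in> C (f i)"
        using a validD(5)[OF v _ _ focc[OF ij(2)]] by blast
      then show ?thesis
      proof
        assume "f j = f (p i)"
        then show ?thesis using finj[of j "p i"] par[of i] ij False by auto
      qed (use own ij in auto)
    qed
  qed
  moreover have "f ` {0..<m} \<subseteq> V" using focc occupied_subset[OF v] by auto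
  moreover have "inj_on f {0..<m}" using F(3) Dm by simp
  ultimately show ?thesis by (intro exI[of _ f]) auto
qed

end

section \<open>Parent orders of trees\<close>

lemma adj_less:
  assumes "is_graph m E" "adj E u v"
  shows "u < m" "v < m"
proof -
  have "{u, v} \<in> all_pairs m" using assms by (auto simp: is_graph_def adj_def)
  then obtain i j where "i < j" "j < m" "{u, v} = {i, j}" unfolding all_pairs_def by blast
  then show "u < m" "v < m" by (auto simp: doubleton_eq_iff)
qed

lemma adj_commute: "adj E u v \<longleftrightarrow> adj E v u"
  by (simp add: adj_def insert_commute)

definition is_path :: "nat set set \<Rightarrow> nat set \<Rightarrow> nat list \<Rightarrow> bool" where
  "is_path E D vs \<longleftrightarrow> distinct vs \<and> vs \<noteq> [] \<and> set vs \<subseteq> D \<and>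
     (\<forall>i. Suc i < length vs \<longrightarrow> adj E (vs ! i) (vs ! Suc i))"

text \<open>Simple paths inside \<open>D\<close>, rather than a transitive closure: a path between
  two neighbours of an outside vertex then closes up to a cycle in the sense of
  \<open>has_cycle\<close>.\<close>

definition path_connected_set :: "nat set set \<Rightarrow> nat set \<Rightarrow> bool" where
  "path_connected_set E D \<longleftrightarrow> (\<forall>x\<in>D. \<forall>y\<in>D. \<exists>vs. is_path E D vs \<and> hd vs = x \<and> last vs = y)"

lemma path_Cons:
  assumes "is_path E D vs" "v \<notin> D" "adj E v (hd vs)"
  shows "is_path E (insert v D) (v # vs)"
proof -
  have "adj E ((v # vs) ! i) ((v # vs) ! Suc i)" if "Suc i < length (v # vs)" for i
    using that assms by (cases i) (auto simp: is_path_def hd_conv_nth)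
  then show ?thesis using assms by (auto simp: is_path_def)
qed

lemma path_rev:
  assumes "is_path E D vs"
  shows "is_path E D (rev vs)"
proof -
  have "adj E (rev vs ! i) (rev vs ! Suc i)" if i: "Suc i < length (rev vs)" for i
  proof -
    have eq: "length vs - Suc i = Suc (length vs - Suc (Suc i))" using i by simp
    have "adj E (vs ! (length vs - Suc (Suc i))) (vs ! Suc (length vs - Suc (Suc i)))"
      using assms i by (auto simp: is_path_def)
    then show ?thesis using i by (simp add: rev_nth eq adj_commute)
  qed
  then show ?thesis using assms by (auto simp: is_path_def)
qed

lemma path_mono: "is_path E D vs \<Longrightarrow> D \<subseteq> D' \<Longrightarrow> is_path E D' vs"
  by (auto simp: is_path_def)

lemma path_connected_insert:
  assumes D: "path_connected_set E D" and v: "v \<notin> D" and x: "x \<in> D" "adj E v x"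
  shows "path_connected_set E (insert v D)"
proof -
  have *: "\<exists>vs. is_path E (insert v D) vs \<and> hd vs = v \<and> last vs = y" if y: "y \<in> D" for y
  proof -
    obtain vs where vs: "is_path E D vs" "hd vs = x" "last vs = y"
      using D x y by (auto simp: path_connected_set_def)
    then have "is_path E (insert v D) (v # vs)" using v x by (intro path_Cons) auto
    then show ?thesis using vs by (intro exI[of _ "v # vs"]) (auto simp: is_path_def)
  qed
  have **: "\<exists>vs. is_path E (insert v D) vs \<and> hd vs = y \<and> last vs = v" if y: "y \<in> D" for y
  proof -
    obtain vs where vs: "is_path E (insert v D) vs" "hd vs = v" "last vs = y" using *[OF y] by auto
    then show ?thesis using path_rev[OF vs(1)]
      by (intro exI[of _ "rev vs"]) (auto simp: hd_rev last_rev)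
  qed
  have "is_path E (insert v D) [v]" by (simp add: is_path_def)
  then have ***: "\<exists>vs. is_path E (insert v D) vs \<and> hd vs = v \<and> last vs = v"
    by (intro exI[of _ "[v]"]) simp
  have "\<exists>vs. is_path E (insert v D) vs \<and> hd vs = y \<and> last vs = z" if "y \<in> D" "z \<in> D" for y z
    using D that path_mono[of E D _ "insert v D"] unfolding path_connected_set_def by blast
  then show ?thesis using * ** *** unfolding path_connected_set_def by auto
qed

lemma acyclic_unique_neighbour:
  assumes acyc: "\<not> has_cycle m E" and D: "path_connected_set E D" "D \<subseteq> {0..<m}"
    and v: "v \<notin> D" "v < m" and x: "x \<in> D" "adj E v x" and y: "y \<in> D" "adj E v y"
  shows "x = y"
proof (rule ccontr)
  assume "x \<noteq> y"
  obtain vs where vs: "is_path E D vs" "hd vs = x" "last vs = y"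
    using D x y unfolding path_connected_set_def by blast
  have p: "is_path E (insert v D) (v # vs)" using vs v x by (intro path_Cons) auto
  have "length vs \<ge> 2"
  proof (rule ccontr)
    assume "\<not> 2 \<le> length vs"
    moreover have "vs \<noteq> []" using vs by (simp add: is_path_def)
    ultimately obtain a where "vs = [a]" by (cases vs; cases "tl vs") auto
    then show False using vs \<open>x \<noteq> y\<close> by simp
  qed
  moreover have "adj E (last (v # vs)) (hd (v # vs))"
    using vs y adj_commute by (auto simp: is_path_def)
  ultimately have "has_cycle m E"
    unfolding has_cycle_def using p D v by (intro exI[of _ "v # vs"]) (auto simp: is_path_def)
  then show False using acyc by simp
qed

lemma connected_leaves_set:
  assumes "connected_graph m E" "is_graph m E" "D \<subseteq> {0..<m}" "D \<noteq> {}" "D \<noteq> {0..<m}"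
  shows "\<exists>v x. v < m \<and> v \<notin> D \<and> x \<in> D \<and> adj E v x"
proof -
  obtain a where a: "a \<in> D" using assms by auto
  have "\<not> {0..<m} \<subseteq> D" using assms by auto
  then obtain c where c: "c < m" "c \<notin> D" using atLeastLessThan_iff by blast
  have "(a, c) \<in> {(x, y). adj E x y}\<^sup>*"
    using assms(1,3) a c by (auto simp: connected_graph_def)
  then have "\<exists>x v. x \<in> D \<and> v \<notin> D \<and> adj E x v"
    using a c(2)
  proof (induction rule: rtrancl_induct)
    case (step y z)
    then show ?case by (cases "y \<in> D") auto
  qed auto
  then obtain x v where xv: "x \<in> D" "v \<notin> D" "adj E x v" by auto
  then show ?thesis using adj_less(2)[OF assms(2)] adj_commute by blast
qed

text \<open>Connectivity supplies an outside vertex adjacent to the part already ordered, and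
  acyclicity leaves it exactly one neighbour there, its parent. Thus \<open>p\<close> determines the
  non-edges too, as an induced embedding requires.\<close>

lemma tree_parent_order:
  assumes "is_tree m E"
  shows "\<exists>g p. bij_betw g {0..<m} {0..<m} \<and> (\<forall>i. 1 \<le> i \<longrightarrow> i < m \<longrightarrow> p i < i) \<and>
    (\<forall>i<m. \<forall>j<m. i \<noteq> j \<longrightarrow> (adj E (g i) (g j) \<longleftrightarrow> (1 \<le> j \<and> p j = i) \<or> (1 \<le> i \<and> p i = j)))"
proof -
  have t: "m \<ge> 1" "is_graph m E" "connected_graph m E" "\<not> has_cycle m E"
    using assms by (auto simp: is_tree_def)
  have "\<exists>g p. inj_on g {0..<k} \<and> g ` {0..<k} \<subseteq> {0..<m} \<and> path_connected_set E (g ` {0..<k}) \<and>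
    (\<forall>i. 1 \<le> i \<longrightarrow> i < k \<longrightarrow> p i < i) \<and>
    (\<forall>i<k. \<forall>j<i. adj E (g i) (g j) \<longleftrightarrow> p i = j)" if "1 \<le> k" "k \<le> m" for k
    using that
  proof (induction k rule: nat_induct_at_least)
    case base
    have "path_connected_set E {0}"
      unfolding path_connected_set_def by (auto simp: is_path_def intro!: exI[of _ "[0]"])
    then show ?case using t(1) by (intro exI[of _ "\<lambda>_. 0"]) auto
  next
    case (Suc k)
    have "k \<le> m" using Suc.prems by simp
    from Suc.IH[OF this] obtain g p where IH: "inj_on g {0..<k}" "g ` {0..<k} \<subseteq> {0..<m}" "path_connected_set E (g ` {0..<k})"
      "\<forall>i. 1 \<le> i \<longrightarrow> i < k \<longrightarrow> p i < i" "\<forall>i<k. \<forall>j<i. adj E (g i) (g j) \<longleftrightarrow> p i = j"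
      by blast
    let ?D = "g ` {0..<k}"
    have "card ?D = k" using IH(1) by (simp add: card_image)
    then have "?D \<noteq> {0..<m}" using Suc by auto
    moreover have "?D \<noteq> {}" using Suc by auto
    ultimately obtain v x where vx: "v < m" "v \<notin> ?D" "x \<in> ?D" "adj E v x"
      using connected_leaves_set[OF t(3,2) IH(2)] by blast
    then obtain c where c: "c < k" "x = g c" by auto
    have new: "adj E v (g j) \<longleftrightarrow> c = j" if "j < k" for j
    proof
      assume "adj E v (g j)"
      then have "g j = x"
        using acyclic_unique_neighbour[OF t(4) IH(3,2) vx(2,1), of "g j" x] vx that by auto
      then show "c = j" using IH(1) c that by (auto simp: inj_on_def)
    qed (use vx c in auto)
    let ?g = "g(k := v)" and ?p = "p(k := c)"
    have im: "?g ` {0..<Suc k} = insert v ?D"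
      by (auto simp: atLeastLessThanSuc)
    have "inj_on ?g {0..<Suc k}"
      using IH(1) vx(2) by (auto simp: inj_on_def atLeastLessThanSuc)
    moreover have "path_connected_set E (insert v ?D)"
      using path_connected_insert[OF IH(3) vx(2,3,4)] .
    moreover have "insert v ?D \<subseteq> {0..<m}" using IH(2) vx(1) by auto
    moreover have "\<forall>i. 1 \<le> i \<longrightarrow> i < Suc k \<longrightarrow> ?p i < i" using IH(4) c by (auto simp: less_Suc_eq)
    moreover have "\<forall>i<Suc k. \<forall>j<i. adj E (?g i) (?g j) \<longleftrightarrow> ?p i = j"
      using IH(5) new by (auto simp: less_Suc_eq)
    ultimately show ?case unfolding im[symmetric] by blast
  qed
  from this[of m] t(1) obtain g p where g: "inj_on g {0..<m}" "g ` {0..<m} \<subseteq> {0..<m}"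
    "\<forall>i. 1 \<le> i \<longrightarrow> i < m \<longrightarrow> p i < i" "\<forall>i<m. \<forall>j<i. adj E (g i) (g j) \<longleftrightarrow> p i = j" by auto
  have "bij_betw g {0..<m} {0..<m}"
    using g(1,2) by (simp add: bij_betw_def endo_inj_surj)
  moreover have "adj E (g i) (g j) \<longleftrightarrow> (1 \<le> j \<and> p j = i) \<or> (1 \<le> i \<and> p i = j)" if "i < m" "j < m" "i \<noteq> j" for i j
  proof (cases "j < i")
    case True
    have "p j \<noteq> i" if "1 \<le> j" using g(3) \<open>j < m\<close> True that by fastforce
    then show ?thesis using g(4) that True by auto
  next
    case False
    then have ij: "i < j" using that by simp
    have "p i \<noteq> j" if "1 \<le> i" using g(3) \<open>i < m\<close> ij that by fastforce
    then show ?thesis using g(4) that ij adj_commute[of E "g i" "g j"] by auto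
  qed
  ultimately show ?thesis using g(3) by blast
qed

section \<open>Induced copies of trees\<close>

lemma finite_all_pairs [simp]: "finite (all_pairs n)"
proof (rule finite_subset)
  show "all_pairs n \<subseteq> Pow {0..<n}" by (auto simp: all_pairs_def)
qed simp

lemma finite_neighbours: "is_graph m E \<Longrightarrow> finite {u. adj E v u}"
  by (rule finite_subset[of _ "{0..<m}"]) (auto dest: adj_less)

text \<open>This serves the case \<Delta> = 0, which the locale excludes: the first edge of a walk
  from 0 to 1 would give 0 a neighbour.\<close>

lemma single_vertex_of_degree_zero:
  assumes "is_tree m F" "max_degree_le m F 0"
  shows "m = 1"
proof (rule ccontr)
  assume "m \<noteq> 1"
  then have m: "0 < m" "1 < m" using assms(1) by (auto simp: is_tree_def)
  have "connected_graph m F" using assms(1) by (simp add: is_tree_def)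
  then have "(0, 1) \<in> {(x, y). adj F x y}\<^sup>*"
    unfolding connected_graph_def using m by (elim allE[of _ 0] impE allE[of _ 1])
  moreover have "(0::nat) \<noteq> 1" by simp
  ultimately obtain y where "(0, y) \<in> {(x, y). adj F x y}" by (meson converse_rtranclE)
  then have "adj F 0 y" by simp
  moreover have "degree F 0 = 0" using assms(2) m by (auto simp: max_degree_le_def)
  \<comment> \<open>Degree 0 means no neighbours only for a finite neighbourhood, as
    \<open>card\<close> of an infinite set is 0.\<close>
  moreover have "finite {u. adj F 0 u}" 
    using assms(1) unfolding is_tree_def by (intro finite_neighbours) blast
  ultimately show False by (auto simp: degree_def)
qed

lemma tree_induced_subgraph:
  assumes sg: "sparse_graph W nb \<Delta> b M u0 u1"
    and V: "W \<noteq> {}" "W \<subseteq> {0..<n}"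
    and nb: "\<And>x y. x \<in> W \<Longrightarrow> y \<in> W \<Longrightarrow> x \<noteq> y \<Longrightarrow> y \<in> nb x \<longleftrightarrow> {x, y} \<in> G"
    and F: "is_tree m F" "max_degree_le m F \<Delta>" "m \<le> M"
  shows "induced_subgraph m F n G"
proof -
  obtain g p where g: "bij_betw g {0..<m} {0..<m}" "\<And>i. 1 \<le> i \<Longrightarrow> i < m \<Longrightarrow> p i < i"
    and adj: "\<And>i j. i < m \<Longrightarrow> j < m \<Longrightarrow> i \<noteq> j \<Longrightarrow>
      adj F (g i) (g j) \<longleftrightarrow> (1 \<le> j \<and> p j = i) \<or> (1 \<le> i \<and> p i = j)"
    using tree_parent_order[OF F(1)] by blast
  have m: "1 \<le> m" "is_graph m F" using F(1) by (auto simp: is_tree_def)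
  have inj: "inj_on g {0..<m}" using g(1) by (simp add: bij_betw_def)
  have gm: "g i < m" if "i < m" for i using g(1) that by (auto simp: bij_betw_def)
  have "card {i \<in> {1..<m}. p i = j} \<le> \<Delta>" if j: "j < m" for j
  proof -
    have sub: "g ` {i \<in> {1..<m}. p i = j} \<subseteq> {u. adj F (g j) u}"
    proof
      fix u assume "u \<in> g ` {i \<in> {1..<m}. p i = j}"
      then obtain i where i: "1 \<le> i" "i < m" "p i = j" "u = g i" by auto
      then have "j \<noteq> i" using g(2)[of i] by auto
      then show "u \<in> {u. adj F (g j) u}" using adj[OF j i(2)] i by auto
    qed
    have "card {i \<in> {1..<m}. p i = j} = card (g ` {i \<in> {1..<m}. p i = j})"
      by (intro card_image[symmetric] inj_on_subset[OF inj]) auto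
    also have "\<dots> \<le> card {u. adj F (g j) u}" using sub finite_neighbours[OF m(2)] by (intro card_mono) auto
    also have "\<dots> \<le> \<Delta>" using F(2) gm[OF j] by (auto simp: max_degree_le_def degree_def)
    finally show ?thesis .
  qed
  with sparse_graph.embed_parent_tree[OF sg, of m p] obtain f where f: "inj_on f {0..<m}" "f ` {0..<m} \<subseteq> W"
    "\<forall>i<m. \<forall>j<m. i \<noteq> j \<longrightarrow> (f j \<in> nb (f i) \<longleftrightarrow> (1 \<le> j \<and> p j = i) \<or> (1 \<le> i \<and> p i = j))"
    using V m F(3) g(2) by blast
  define g' where "g' = inv_into {0..<m} g"
  have g': "bij_betw g' {0..<m} {0..<m}" unfolding g'_def using g(1) by (rule bij_betw_inv_into)
  have gg': "g (g' u) = u" "g' u < m" if "u < m" for u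
    using that g(1) g' bij_betw_inv_into_right[OF g(1), of u] by (auto simp: g'_def bij_betw_def)
  have "inj_on (f \<circ> g') {0..<m}" "(f \<circ> g') ` {0..<m} \<subseteq> W"
    using g' f(1,2) by (auto simp: bij_betw_def comp_inj_on image_comp[symmetric])
  moreover have "{u, v} \<in> F \<longleftrightarrow> {f (g' u), f (g' v)} \<in> G" if uv: "u < m" "v < m" "u \<noteq> v" for u v
  proof -
    have d: "g' u \<noteq> g' v" using uv gg' by metis
    then have "f (g' u) \<noteq> f (g' v)" using f(1) uv gg'(2) by (auto simp: inj_on_def)
    then have "{f (g' u), f (g' v)} \<in> G \<longleftrightarrow> f (g' v) \<in> nb (f (g' u))"
      using f(2) gg'(2) uv by (intro nb[symmetric]) auto
    also have "\<dots> \<longleftrightarrow> adj F (g (g' u)) (g (g' v))" using f(3) adj d gg'(2) uv by auto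
    finally show ?thesis using gg' uv by (simp add: adj_def)
  qed
  ultimately show ?thesis
    unfolding induced_subgraph_def using V(2) by (intro exI[of _ "f \<circ> g'"]) auto
qed

section \<open>Density of random graphs\<close>

definition pairs :: "nat set \<Rightarrow> nat set set" where
  "pairs U = {e. e \<subseteq> U \<and> card e = 2}"

lemma all_pairs_eq: "all_pairs n = pairs {0..<n}"
proof
  show "all_pairs n \<subseteq> pairs {0..<n}"
  proof
    fix e assume "e \<in> all_pairs n"
    then obtain i j where "i < j" "j < n" "e = {i, j}" unfolding all_pairs_def by blast
    then show "e \<in> pairs {0..<n}" by (simp add: pairs_def)
  qed
  show "pairs {0..<n} \<subseteq> all_pairs n"
  proof
    fix e assume "e \<in> pairs {0..<n}"
    then obtain i j where ij: "e = {i, j}" "i \<noteq> j" "i < n" "j < n"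
      by (auto simp: pairs_def card_2_iff)
    show "e \<in> all_pairs n"
    proof (cases "i < j")
      case True
      then show ?thesis using ij unfolding all_pairs_def by blast
    next
      case False
      then have "j < i" "e = {j, i}" using ij by auto
      then show ?thesis using ij unfolding all_pairs_def by blast
    qed
  qed
qed

lemma finite_pairs [simp]: "finite U \<Longrightarrow> finite (pairs U)"
  unfolding pairs_def by (rule finite_subset[of _ "Pow U"]) auto

lemma card_pairs: "finite U \<Longrightarrow> card (pairs U) = card U choose 2"
  unfolding pairs_def by (rule n_subsets)

lemma pairs_mono: "U \<subseteq> W \<Longrightarrow> pairs U \<subseteq> pairs W"
  by (auto simp: pairs_def)

definition nbrs :: "nat set set \<Rightarrow> nat set \<Rightarrow> nat \<Rightarrow> nat set" where
  "nbrs G V x = {y \<in> V. x \<in> V \<and> x \<noteq> y \<and> {x, y} \<in> G}"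

lemma card_nbrs:
  assumes "x \<in> U"
  shows "card (nbrs G U x) = card {e \<in> G \<inter> pairs U. x \<in> e}"
proof -
  have "bij_betw (\<lambda>y. {x, y}) (nbrs G U x) {e \<in> G \<inter> pairs U. x \<in> e}"
    unfolding bij_betw_def
  proof (intro conjI equalityI subsetI)
    show "inj_on (\<lambda>y. {x, y}) (nbrs G U x)" by (auto simp: inj_on_def doubleton_eq_iff)
    show "e \<in> {e \<in> G \<inter> pairs U. x \<in> e}" if "e \<in> (\<lambda>y. {x, y}) ` nbrs G U x" for e
      using that by (auto simp: nbrs_def pairs_def)
    show "e \<in> (\<lambda>y. {x, y}) ` nbrs G U x" if "e \<in> {e \<in> G \<inter> pairs U. x \<in> e}" for e
    proof -
      have e: "e \<in> G" "e \<subseteq> U" "card e = 2" "x \<in> e" using that by (auto simp: pairs_def)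
      then obtain y where "e = {x, y}" "x \<noteq> y" by (metis card_2_iff doubleton_eq_iff insertE singletonD)
      then show ?thesis using e by (auto simp: nbrs_def)
    qed
  qed
  then show ?thesis by (rule bij_betw_same_card)
qed

lemma degree_sum_eq:
  assumes "finite U"
  shows "(\<Sum>x\<in>U. card (nbrs G U x)) = 2 * card (G \<inter> pairs U)"
proof -
  let ?E = "G \<inter> pairs U"
  have fin: "finite ?E" using assms by simp
  have "(\<Sum>x\<in>U. card (nbrs G U x)) = (\<Sum>x\<in>U. \<Sum>e\<in>?E. if x \<in> e then 1 else 0)"
    using fin by (intro sum.cong) (auto simp: card_nbrs sum.If_cases Int_def conj_ac)
  also have "\<dots> = (\<Sum>e\<in>?E. \<Sum>x\<in>U. if x \<in> e then 1 else 0)" by (rule sum.swap)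
  also have "\<dots> = (\<Sum>e\<in>?E. 2)"
  proof (intro sum.cong refl)
    fix e assume "e \<in> ?E"
    then have "U \<inter> {x. x \<in> e} = e" "card e = 2" by (auto simp: pairs_def)
    then show "(\<Sum>x\<in>U. if x \<in> e then 1 else 0) = (2::nat)" using assms by (simp add: sum.If_cases)
  qed
  finally show ?thesis by simp
qed

text \<open>Deleting a vertex of degree below \<open>k\<close> loses fewer than \<open>k\<close>
  edges, so the edge bound survives strictly. Hence some edge remains, and the deletions stop before
  the set is empty.\<close>

lemma min_degree_subset:
  assumes "finite W" "W \<noteq> {}" "1 \<le> k" "k * card W \<le> card (G \<inter> pairs W)"
  shows "\<exists>V\<subseteq>W. V \<noteq> {} \<and> (\<forall>x\<in>V. k \<le> card (nbrs G V x))"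
  using assms
proof (induction "card W" arbitrary: W rule: less_induct)
  case less
  show ?case
  proof (cases "\<forall>x\<in>W. k \<le> card (nbrs G W x)")
    case True
    then show ?thesis using less.prems by blast
  next
    case False
    then obtain x where x: "x \<in> W" "card (nbrs G W x) < k" by auto
    let ?W = "W - {x}"
    have eq: "G \<inter> pairs W = (G \<inter> pairs ?W) \<union> {e \<in> G \<inter> pairs W. x \<in> e}"
      by (auto simp: pairs_def)
    have "card (G \<inter> pairs W) \<le> card (G \<inter> pairs ?W) + card (nbrs G W x)"
      using card_Un_le[of "G \<inter> pairs ?W" "{e \<in> G \<inter> pairs W. x \<in> e}"] card_nbrs[OF x(1), of G] eq by simp
    moreover have cW: "card W = Suc (card ?W)" using x less.prems by (metis card_Suc_Diff1)
    ultimately have 1: "k * card ?W < card (G \<inter> pairs ?W)" using less.prems(4) x(2) by simp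
    have "pairs {} = {}" by (auto simp: pairs_def)
    then have "?W \<noteq> {}" using 1 by (metis Int_empty_right card.empty not_less_zero)
    then obtain V where "V \<subseteq> ?W" "V \<noteq> {}" "\<forall>x\<in>V. k \<le> card (nbrs G V x)"
      using less.hyps[of ?W] less.prems 1 cW by auto
    then show ?thesis by blast
  qed
qed

section \<open>First moment and exponential moment bounds\<close>

lemma prob_edges_subset:
  assumes "0 \<le> p" "p \<le> 1" "F \<subseteq> all_pairs n"
  shows "measure_pmf.prob (gnp n p) {G. F \<subseteq> G} = p ^ card F"
proof -
  let ?Q = "Pi_pmf (all_pairs n) False (\<lambda>_. bernoulli_pmf p)"
  have "measure_pmf.prob (gnp n p) {G. F \<subseteq> G} = measure_pmf.prob ?Q {f. F \<subseteq> {e. f e}}"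
    by (simp add: gnp_def vimage_def)
  also have "{f. F \<subseteq> {e. f e}} = Pi (all_pairs n) (\<lambda>e. if e \<in> F then {True} else UNIV)"
    using assms(3) by (auto simp: Pi_def split: if_splits)
  also have "measure_pmf.prob ?Q \<dots> = (\<Prod>e\<in>all_pairs n. measure_pmf.prob (bernoulli_pmf p) (if e \<in> F then {True} else UNIV))"
    by (intro measure_Pi_pmf_Pi) simp
  also have "\<dots> = (\<Prod>e\<in>all_pairs n. if e \<in> F then p else 1)"
    using assms by (intro prod.cong) (auto simp: measure_pmf_single)
  also have "\<dots> = p ^ card F"
    using assms(3) by (simp add: prod.If_cases Int_absorb1)
  finally show ?thesis .
qed

text \<open>Union bound over the sets \<open>U\<close> of size \<open>u\<close> and over the
  possible choices of \<open>s\<close> edges inside \<open>U\<close>.\<close>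

lemma prob_dense_subset_le:
  assumes p: "0 \<le> p" "p \<le> 1" and W: "W \<subseteq> {0..<n}"
  shows "measure_pmf.prob (gnp n p) {G. \<exists>U\<subseteq>W. card U = u \<and> s \<le> card (G \<inter> pairs U)}
    \<le> real (card W choose u) * real ((u choose 2) choose s) * p ^ s"
proof -
  let ?P = "measure_pmf.prob (gnp n p)"
  have finW: "finite W" using W finite_subset by blast
  define \<U> where "\<U> = {U. U \<subseteq> W \<and> card U = u}"
  define \<F> where "\<F> U = {F. F \<subseteq> pairs U \<and> card F = s}" for U
  have fU: "finite \<U>" unfolding \<U>_def using finW by simp
  have U: "finite U" "card U = u" "pairs U \<subseteq> all_pairs n" if "U \<in> \<U>" for U
  proof -
    have UW: "U \<subseteq> W" "card U = u" using that by (simp_all add: \<U>_def)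
    show "finite U" using UW(1) finW by (rule finite_subset)
    show "card U = u" by (rule UW(2))
    show "pairs U \<subseteq> all_pairs n"
      unfolding all_pairs_eq using UW(1) W by (intro pairs_mono) (rule order_trans)
  qed
  have fF: "finite (\<F> U)" if "U \<in> \<U>" for U
    unfolding \<F>_def using U(1)[OF that] by simp
  have "{G. \<exists>U\<subseteq>W. card U = u \<and> s \<le> card (G \<inter> pairs U)} \<subseteq> (\<Union>U\<in>\<U>. \<Union>F\<in>\<F> U. {G. F \<subseteq> G})"
  proof
    fix G assume "G \<in> {G. \<exists>U\<subseteq>W. card U = u \<and> s \<le> card (G \<inter> pairs U)}"
    then obtain U where 1: "U \<subseteq> W" "card U = u" "s \<le> card (G \<inter> pairs U)" by auto
    obtain F where "F \<subseteq> G \<inter> pairs U" "card F = s" using obtain_subset_with_card_n[OF 1(3)] by metis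
    then have "F \<in> \<F> U" "F \<subseteq> G" "U \<in> \<U>" using 1 by (auto simp: \<F>_def \<U>_def)
    then show "G \<in> (\<Union>U\<in>\<U>. \<Union>F\<in>\<F> U. {G. F \<subseteq> G})" by blast
  qed
  then have "?P {G. \<exists>U\<subseteq>W. card U = u \<and> s \<le> card (G \<inter> pairs U)} \<le> ?P (\<Union>U\<in>\<U>. \<Union>F\<in>\<F> U. {G. F \<subseteq> G})"
    by (intro measure_pmf.finite_measure_mono) auto
  also have "\<dots> \<le> (\<Sum>U\<in>\<U>. ?P (\<Union>F\<in>\<F> U. {G. F \<subseteq> G}))"
    using fU by (intro measure_pmf.finite_measure_subadditive_finite) auto
  also have "\<dots> \<le> (\<Sum>U\<in>\<U>. real ((u choose 2) choose s) * p ^ s)"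
  proof (intro sum_mono)
    fix U assume U': "U \<in> \<U>"
    have "?P (\<Union>F\<in>\<F> U. {G. F \<subseteq> G}) \<le> (\<Sum>F\<in>\<F> U. ?P {G. F \<subseteq> G})"
      using fF[OF U'] by (intro measure_pmf.finite_measure_subadditive_finite) auto
    also have "\<dots> = (\<Sum>F\<in>\<F> U. p ^ s)"
    proof (intro sum.cong refl)
      fix F assume "F \<in> \<F> U"
      then have F: "F \<subseteq> pairs U" "card F = s" by (simp_all add: \<F>_def)
      show "?P {G. F \<subseteq> G} = p ^ s"
        using prob_edges_subset[OF p order_trans[OF F(1) U(3)[OF U']]] F(2) by simp
    qed
    also have "\<dots> = real (card (\<F> U)) * p ^ s" by simp
    also have "card (\<F> U) = (u choose 2) choose s"
      unfolding \<F>_def using U[OF U'] by (simp add: n_subsets card_pairs)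
    finally show "?P (\<Union>F\<in>\<F> U. {G. F \<subseteq> G}) \<le> real ((u choose 2) choose s) * p ^ s" .
  qed
  also have "\<dots> = real (card \<U>) * (real ((u choose 2) choose s) * p ^ s)" by simp
  also have "card \<U> = card W choose u" unfolding \<U>_def using finW by (rule n_subsets)
  finally show ?thesis by (simp add: mult.assoc)
qed

text \<open>Markov's inequality for (1/2)^X, where \<open>X\<close> is the number of edges inside
  \<open>W\<close>: by independence each pair in \<open>W\<close> contributes a factor 1 - p/2 to
  the expectation.\<close>

lemma prob_few_edges_le:
  assumes p: "0 \<le> p" "p \<le> 1" and W: "W \<subseteq> {0..<n}"
  shows "measure_pmf.prob (gnp n p) {G. card (G \<inter> pairs W) < t} \<le> 2 ^ t * (1 - p / 2) ^ (card W choose 2)"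
proof -
  let ?Q = "Pi_pmf (all_pairs n) False (\<lambda>_. bernoulli_pmf p)"
  let ?g = "\<lambda>e v. if e \<in> pairs W \<and> v then 1 / 2 else (1::real)"
  have finW: "finite W" using W finite_subset by blast
  have sub: "pairs W \<subseteq> all_pairs n" using pairs_mono[OF W] by (simp add: all_pairs_eq)
  have pr: "(\<Prod>e\<in>all_pairs n. ?g e (f e)) = (1 / 2) ^ card ({e. f e} \<inter> pairs W)" for f
  proof -
    have "all_pairs n \<inter> {e. e \<in> pairs W \<and> f e} = {e. f e} \<inter> pairs W" using sub by auto
    then show ?thesis by (simp add: prod.If_cases)
  qed
  have "measure_pmf.prob (gnp n p) {G. card (G \<inter> pairs W) < t}
      = measure_pmf.prob ?Q {f. card ({e. f e} \<inter> pairs W) < t}"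
    by (simp add: gnp_def vimage_def)
  also have "\<dots> = measure_pmf.expectation ?Q (indicator {f. card ({e. f e} \<inter> pairs W) < t})"
    by simp
  also have "\<dots> \<le> measure_pmf.expectation ?Q (\<lambda>f. 2 ^ t * (\<Prod>e\<in>all_pairs n. ?g e (f e)))"
  proof (intro integral_mono)
    show "integrable (measure_pmf ?Q) (\<lambda>f. 2 ^ t * (\<Prod>e\<in>all_pairs n. ?g e (f e)))"
      by (intro integrable_mult_right integrable_prod_Pi_pmf) (auto intro: integrable_measure_pmf_finite)
    fix f
    show "indicator {f. card ({e. f e} \<inter> pairs W) < t} f \<le> 2 ^ t * (\<Prod>e\<in>all_pairs n. ?g e (f e))"
      unfolding pr by (auto simp: indicator_def field_simps power_divide intro!: power_increasing)
  qed (intro measure_pmf.integrable_const_bound[where B = 1], auto)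
  also have "\<dots> = 2 ^ t * (\<Prod>e\<in>all_pairs n. measure_pmf.expectation (bernoulli_pmf p) (?g e))"
    by (subst integral_mult_right_zero, subst expectation_prod_Pi_pmf)
      (auto intro: integrable_measure_pmf_finite)
  also have "(\<Prod>e\<in>all_pairs n. measure_pmf.expectation (bernoulli_pmf p) (?g e))
      = (\<Prod>e\<in>all_pairs n. if e \<in> pairs W then 1 - p / 2 else 1)"
    using p by (intro prod.cong) (auto simp: field_simps)
  also have "\<dots> = (1 - p / 2) ^ card (pairs W)" using sub by (simp add: prod.If_cases Int_absorb1)
  finally show ?thesis using finW by (simp add: card_pairs)
qed

text \<open>The \<open>k\<close>-th term of the exponential series at \<open>k\<close> is at most
  its sum, so k^k / k! \<le> e^k \<le> 3^k.\<close>

lemma binomial_le_power: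
  assumes "1 \<le> k"
  shows "real (n choose k) \<le> (3 * real n / real k) ^ k"
proof -
  have "real k ^ k / fact k \<le> exp (real k)"
  proof -
    have "(\<Sum>i\<in>{k}. real k ^ i /\<^sub>R fact i) \<le> (\<Sum>i. real k ^ i /\<^sub>R fact i)"
      by (intro sum_le_suminf summable_exp_generic) auto
    then show ?thesis by (simp add: exp_def divide_inverse mult.commute)
  qed
  also have "exp (real k) = exp 1 ^ k" by (simp add: exp_of_nat_mult[symmetric])
  also have "\<dots> \<le> 3 ^ k" using exp_le by (intro power_mono) auto
  finally have k: "real k ^ k \<le> 3 ^ k * fact k" by (simp add: field_simps)
  have "real ((n choose k) * fact k) \<le> real (n ^ k)" using binomial_fact_pow of_nat_mono by blast
  then have "real (n choose k) * fact k \<le> real n ^ k" by simp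
  then have "real (n choose k) * real k ^ k * fact k \<le> (3 * real n) ^ k * fact k"
    using k mult_mono[of "real (n choose k) * fact k" "real n ^ k" "real k ^ k" "3 ^ k * fact k"]
    by (simp add: power_mult_distrib mult_ac)
  then have "real (n choose k) * real k ^ k \<le> (3 * real n) ^ k" by simp
  then show ?thesis using assms by (simp add: power_divide field_simps)
qed

text \<open>Raising to the \<open>q\<close>-th power clears the fractional exponent \<open>(q + 1) u / q\<close> of the first moment bound.\<close>

lemma dense_term_le:
  fixes p D :: real
  assumes u: "1 \<le> u" and q: "1 \<le> q" and s: "(q + 1) * u \<le> q * s"
    and p: "0 \<le> p" "p * real N \<le> D" "3 * real u * p / 2 \<le> 1" and N: "1 \<le> N"
  shows "(real (N choose u) * real ((u choose 2) choose s) * p ^ s) ^ q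
    \<le> (3 ^ (2 * q + 1) / 2 ^ (q + 1) * D ^ (q + 1) / real N * real u) ^ u"
proof -
  have us: "u \<le> s"
  proof -
    have "q * u \<le> (q + 1) * u" by simp
    then have "q * u \<le> q * s" using s by (rule order_trans)
    then show ?thesis using q by (simp only: mult_le_cancel1)
  qed
  have c2: "real (u choose 2) \<le> real u * real u / 2"
  proof -
    have "u choose 2 \<le> u * u div 2" unfolding choose_two by (intro div_le_mono mult_le_mono2) auto
    then have "real (u choose 2) \<le> real (u * u div 2)" by (rule of_nat_mono)
    also have "\<dots> \<le> real (u * u) / 2" using of_nat_div_le_of_nat[of "u * u" 2, where ?'a = real] by simp
    finally show ?thesis by simp
  qed
  have "real ((u choose 2) choose s) \<le> (3 * real (u choose 2) / real s) ^ s"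
    using us u by (intro binomial_le_power) auto
  also have "\<dots> \<le> (3 * real u / 2) ^ s"
  proof (intro power_mono)
    have "real (u choose 2) \<le> real u * real s / 2"
      using c2 us by (meson divide_right_mono mult_left_mono of_nat_0_le_iff of_nat_mono order_trans zero_le_numeral)
    then show "3 * real (u choose 2) / real s \<le> 3 * real u / 2"
      using us u by (simp add: field_simps)
  qed auto
  finally have "real ((u choose 2) choose s) * p ^ s \<le> (3 * real u / 2) ^ s * p ^ s"
    using p by (intro mult_right_mono) auto
  also have "\<dots> = (3 * real u * p / 2) ^ s" by (simp add: power_mult_distrib[symmetric])
  finally have "real (N choose u) * (real ((u choose 2) choose s) * p ^ s)
      \<le> (3 * real N / real u) ^ u * (3 * real u * p / 2) ^ s"
    using p binomial_le_power[OF u, of N] by (intro mult_mono) auto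
  then have "(real (N choose u) * real ((u choose 2) choose s) * p ^ s) ^ q
      \<le> ((3 * real N / real u) ^ u * (3 * real u * p / 2) ^ s) ^ q"
    using p by (intro power_mono) (auto simp: mult.assoc)
  also have "\<dots> = (3 * real N / real u) ^ (u * q) * (3 * real u * p / 2) ^ (q * s)"
    by (simp add: power_mult_distrib power_mult[symmetric] mult.commute)
  \<comment> \<open>The base 3 u p / 2 is at most 1, so lowering its exponent to (q + 1) u only
    increases the power.\<close>
  also have "\<dots> \<le> (3 * real N / real u) ^ (u * q) * (3 * real u * p / 2) ^ ((q + 1) * u)"
    using p s by (intro mult_left_mono power_decreasing) auto
  also have "\<dots> = ((3 * real N / real u) ^ q * (3 * real u * p / 2) ^ (q + 1)) ^ u"
    by (simp only: power_mult[symmetric] power_mult_distrib mult.commute[of u])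
  also have "(3 * real N / real u) ^ q * (3 * real u * p / 2) ^ (q + 1)
      = 3 ^ (2 * q + 1) / 2 ^ (q + 1) * (p * real N) ^ (q + 1) / real N * real u"
  proof -
    have "(3::real) ^ (2 * q + 1) = 3 * 3 ^ q * 3 ^ q" by (simp add: mult_2 power_add)
    then show ?thesis using u N by (simp add: power_mult_distrib power_divide)
  qed
  also have "\<dots> ^ u \<le> (3 ^ (2 * q + 1) / 2 ^ (q + 1) * D ^ (q + 1) / real N * real u) ^ u"
    using p by (intro power_mono mult_right_mono divide_right_mono mult_left_mono) auto
  finally show ?thesis .
qed

text \<open>The infinite series has sum 1 / (1 - 1/2)^2 = 4. The induction is carried by the
  identity that includes the exact remainder.\<close>

lemma sum_geometric_linear_le: "(\<Sum>u=1..n. real u * (1 / 2) ^ (u - 1)) \<le> 4"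
proof -
  have "(\<Sum>u=1..n. real u * r ^ (u - 1)) + (real n + 2) * 2 * r ^ n = 4" if r: "r = 1 / 2" for r :: real
  proof (induction n)
    case (Suc n)
    have "(real (Suc n) + 2) * 2 * r ^ Suc n = (2 * r) * ((real n + 3) * r ^ n)" by (simp add: algebra_simps)
    moreover have "2 * r = 1" using r by simp
    ultimately have "(real (Suc n) + 2) * 2 * r ^ Suc n = (real n + 3) * r ^ n" by (simp only: mult_1_left)
    then show ?case using Suc by (simp add: algebra_simps)
  qed simp
  from this[of "1 / 2"] have "(\<Sum>u=1..n. real u * (1 / 2) ^ (u - 1)) + (real n + 2) * 2 * (1 / 2) ^ n = 4" by simp
  moreover have "0 \<le> (real n + 2) * 2 * (1 / 2 :: real) ^ n" by simp
  ultimately show ?thesis by linarith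
qed

text \<open>By \<open>dense_term_le\<close> the term for size \<open>u\<close> is at most the
  \<open>u\<close>-th power of \<open>root q (\<alpha> * u)\<close>. One factor is kept and makes
  the bound vanish with \<alpha>; the other u - 1 factors are at most 1/2 by the choice of
  \<open>um\<close>, so the sum over \<open>u\<close> converges.\<close>

lemma prob_not_sparse_le:
  fixes p D :: real
  assumes q: "1 \<le> q" and p: "0 \<le> p" "p \<le> 1" "p * real N \<le> D" and N: "1 \<le> N" "N \<le> n" and D: "1 \<le> D"
    and \<alpha>: "\<alpha> = 3 ^ (2 * q + 1) / 2 ^ (q + 1) * D ^ (q + 1) / real N"
    and um: "\<alpha> * real um \<le> (1 / 2) ^ q"
  shows "measure_pmf.prob (gnp n p)
      {G. \<exists>U\<subseteq>{0..<N}. 1 \<le> card U \<and> card U \<le> um \<and> (q + 1) * card U < q * card (G \<inter> pairs U)}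
    \<le> 4 * root q \<alpha>"
proof -
  let ?P = "measure_pmf.prob (gnp n p)"
  \<comment> \<open>The least integer exceeding (q + 1) u / q, which turns the strict inequality of
    the event into a lower bound on the number of edges.\<close>
  define s where "s u = (q + 1) * u div q + 1" for u
  let ?A = "\<lambda>u. {G. \<exists>U\<subseteq>{0..<N}. card U = u \<and> s u \<le> card (G \<inter> pairs U)}"
  have \<alpha>0: "0 < \<alpha>" using D N by (simp add: \<alpha>)
  \<comment> \<open>This lets \<alpha> u \<le> 1 imply the side condition 3 u p / 2 \<le> 1 of
    \<open>dense_term_le\<close>.\<close>
  have \<alpha>D: "3 / 2 * D / real N \<le> \<alpha>"
  proof -
    have "1 \<le> (9 / 2 :: real) ^ q * D ^ q" using D by (simp add: power_mult_distrib[symmetric])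
    then have "3 / 2 * D / real N * 1 \<le> 3 / 2 * D / real N * ((9 / 2) ^ q * D ^ q)"
      using D by (intro mult_left_mono) auto
    also have "\<dots> = \<alpha>"
    proof -
      have "(3::real) ^ (2 * q) = 9 ^ q" by (simp add: power_mult)
      then show ?thesis by (simp add: \<alpha> power_divide mult_ac)
    qed
    finally show ?thesis by simp
  qed
  have "{G. \<exists>U\<subseteq>{0..<N}. 1 \<le> card U \<and> card U \<le> um \<and> (q + 1) * card U < q * card (G \<inter> pairs U)}
      \<subseteq> (\<Union>u\<in>{1..um}. ?A u)"
  proof
    fix G assume "G \<in> {G. \<exists>U\<subseteq>{0..<N}. 1 \<le> card U \<and> card U \<le> um \<and> (q + 1) * card U < q * card (G \<inter> pairs U)}"
    then obtain U where U: "U \<subseteq> {0..<N}" "1 \<le> card U" "card U \<le> um"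
      "(q + 1) * card U < q * card (G \<inter> pairs U)" by auto
    have "(q + 1) * card U div q < card (G \<inter> pairs U)"
      using U(4) by (intro less_mult_imp_div_less) (simp only: mult.commute[of q])
    then have "s (card U) \<le> card (G \<inter> pairs U)" by (simp add: s_def)
    then show "G \<in> (\<Union>u\<in>{1..um}. ?A u)" using U by (intro UN_I[of "card U"]) auto
  qed
  then have "?P {G. \<exists>U\<subseteq>{0..<N}. 1 \<le> card U \<and> card U \<le> um \<and> (q + 1) * card U < q * card (G \<inter> pairs U)}
      \<le> ?P (\<Union>u\<in>{1..um}. ?A u)" by (intro measure_pmf.finite_measure_mono) auto
  also have "\<dots> \<le> (\<Sum>u\<in>{1..um}. ?P (?A u))"
    by (intro measure_pmf.finite_measure_subadditive_finite) auto
  also have "\<dots> \<le> (\<Sum>u\<in>{1..um}. root q \<alpha> * (real u * (1 / 2) ^ (u - 1)))"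
  proof (intro sum_mono)
    fix u assume u: "u \<in> {1..um}"
    let ?T = "real (N choose u) * real ((u choose 2) choose s u) * p ^ s u"
    have \<alpha>u: "\<alpha> * real u \<le> (1 / 2) ^ q"
    proof -
      have "\<alpha> * real u \<le> \<alpha> * real um" using u \<alpha>0 by simp
      then show ?thesis using um by linarith
    qed
    have "p \<le> D / real N" using p N by (simp add: field_simps)
    then have "3 * real u * p / 2 \<le> 3 * real u * (D / real N) / 2"
      by (intro divide_right_mono mult_left_mono) auto
    also have "\<dots> = 3 / 2 * D / real N * real u" by (simp add: mult_ac)
    also have "\<dots> \<le> \<alpha> * real u" using \<alpha>D by (intro mult_right_mono) auto
    also have "\<dots> \<le> 1" using \<alpha>u by (rule order_trans) (simp add: power_le_one)
    finally have small: "3 * real u * p / 2 \<le> 1" .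
    have "(q + 1) * u \<le> q * s u"
    proof -
      have "(q + 1) * u = q * ((q + 1) * u div q) + (q + 1) * u mod q"
        by (rule mult_div_mod_eq[symmetric])
      moreover have "(q + 1) * u mod q < q" using q by simp
      ultimately show ?thesis unfolding s_def 
        by (simp only: distrib_left mult_1_right add_le_cancel_left less_imp_le)
    qed
    then have Tq: "?T ^ q \<le> (\<alpha> * real u) ^ u"
      unfolding \<alpha> using dense_term_le[of u q "s u" p N D] u q p small N by simp
    have T0: "0 \<le> ?T" using p by simp
    have "?T = root q (?T ^ q)" using T0 q by (simp add: real_root_power_cancel)
    also have "\<dots> \<le> root q ((\<alpha> * real u) ^ u)" using Tq q by (intro real_root_le_mono) auto
    also have "\<dots> = root q (\<alpha> * real u) ^ u" using q by (simp add: real_root_power)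
    also have "\<dots> = root q (\<alpha> * real u) * root q (\<alpha> * real u) ^ (u - 1)"
      using u by (cases u) auto
    also have "\<dots> \<le> (root q \<alpha> * real u) * (1 / 2) ^ (u - 1)"
    proof (intro mult_mono power_mono)
      have "root q (\<alpha> * real u) \<le> root q ((1 / 2) ^ q)" using \<alpha>u q by (intro real_root_le_mono) auto
      then show "root q (\<alpha> * real u) \<le> 1 / 2" using q by (simp add: real_root_power_cancel)
      have "root q (real u) \<le> root q (real u ^ q)" using u q
        by (intro real_root_le_mono) (auto intro: self_le_power)
      then have "root q (real u) \<le> real u" using q by (simp add: real_root_power_cancel)
      then show "root q (\<alpha> * real u) \<le> root q \<alpha> * real u"
        using \<alpha>0 q by (simp add: real_root_mult mult_left_mono)
    qed (use \<alpha>0 q in auto)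
    finally have "?T \<le> root q \<alpha> * (real u * (1 / 2) ^ (u - 1))" by (simp add: mult.assoc)
    moreover have "?P (?A u) \<le> ?T"
      using prob_dense_subset_le[OF p(1,2), of "{0..<N}" n u "s u"] N by simp
    ultimately show "?P (?A u) \<le> root q \<alpha> * (real u * (1 / 2) ^ (u - 1))" by linarith
  qed
  also have "\<dots> = root q \<alpha> * (\<Sum>u=1..um. real u * (1 / 2) ^ (u - 1))" by (simp add: sum_distrib_left)
  also have "\<dots> \<le> root q \<alpha> * 4" using \<alpha>0 q by (intro mult_left_mono sum_geometric_linear_le) auto
  finally show ?thesis by (simp add: mult.commute)
qed

section \<open>Combining the embedding with the probability bounds\<close>

lemma trees_induced_if_sparse:
  assumes \<Delta>: "1 \<le> \<Delta>" and N: "1 \<le> N" "N \<le> n"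
    and dense: "(58 * \<Delta> + 36) * N \<le> card (G \<inter> pairs {0..<N})"
    and s0: "\<And>U. U \<subseteq> {0..<N} \<Longrightarrow> 1 \<le> card U \<Longrightarrow> card U \<le> u0 \<Longrightarrow> 2 * card (G \<inter> pairs U) \<le> 3 * card U"
    and s1: "\<And>U. U \<subseteq> {0..<N} \<Longrightarrow> 1 \<le> card U \<Longrightarrow> card U \<le> u1 \<Longrightarrow> 3 * card (G \<inter> pairs U) \<le> 4 * card U"
    and u: "M + \<Delta> * b + (b + 1) * (13 + 48 * \<Delta>) \<le> u0" "51 * b + 7 \<le> u1" "M \<le> 3 * \<Delta> * (b + 1)"
    and F: "is_tree m F" "max_degree_le m F \<Delta>" "m \<le> M"
  shows "induced_subgraph m F n G"
proof -
  obtain V where V: "V \<subseteq> {0..<N}" "V \<noteq> {}" "\<forall>x\<in>V. 58 * \<Delta> + 36 \<le> card (nbrs G V x)"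
    using min_degree_subset[of "{0..<N}" "58 * \<Delta> + 36" G] N dense by auto
  have nbrs_Int: "nbrs G V x \<inter> U = nbrs G U x" if "U \<subseteq> V" "x \<in> U" for x U
    using that by (auto simp: nbrs_def)
  have deg: "(\<Sum>x\<in>U. card (nbrs G V x \<inter> U)) = 2 * card (G \<inter> pairs U)" if "U \<subseteq> V" for U
  proof -
    have "finite U" using that V(1) by (meson finite_atLeastLessThan finite_subset)
    then show ?thesis using degree_sum_eq[of U G] nbrs_Int[OF that] by simp
  qed
  have card1: "1 \<le> card U" if "U \<subseteq> V" "U \<noteq> {}" for U
    using that V(1) by (metis One_nat_def Suc_leI card_gt_0_iff finite_atLeastLessThan finite_subset order_trans)
  have "sparse_graph V (nbrs G V) \<Delta> b M u0 u1"
  proof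
    show "finite V" using V(1) finite_subset by blast
    show "(\<Sum>x\<in>U. card (nbrs G V x \<inter> U)) \<le> 3 * card U" if "U \<subseteq> V" "card U \<le> u0" for U
      using s0[of U] that V(1) card1[of U] deg[OF that(1)] by (cases "U = {}") auto
    show "3 * (\<Sum>x\<in>U. card (nbrs G V x \<inter> U)) \<le> 8 * card U" if "U \<subseteq> V" "card U \<le> u1" for U
      using s1[of U] that V(1) card1[of U] deg[OF that(1)] by (cases "U = {}") auto
  qed (use V(3) u \<Delta> in \<open>auto simp: nbrs_def insert_commute\<close>)
  then show ?thesis
    using V N F by (intro tree_induced_subgraph[where W = V]) (auto simp: nbrs_def)
qed

text \<open>It yields 1000 \<Delta> \<le> d, so that the initial segment of length \<open>N\<close>
  fits into the \<open>n\<close> vertices.\<close>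

lemma thousand_le_power: "1 \<le> \<Delta> \<Longrightarrow> 1000 * real \<Delta> \<le> 2 ^ (20 * \<Delta>)"
proof (induction \<Delta> rule: nat_induct_at_least)
  case (Suc k)
  have "(2::real) ^ (20 * Suc k) = 1048576 * 2 ^ (20 * k)" by (simp add: power_add)
  moreover have "(1::real) \<le> 2 ^ (20 * k)" by simp
  ultimately show ?case using Suc by simp
qed simp

text \<open>The initial segment \<open>{0..<N}\<close> induces a random graph of average degree about \<open>1000 \<Delta> = O(ln d)\<close>.
  Sparsity \<open>2 e(U) \<le> 3 |U|\<close> there holds up to \<open>|U| = c (N / \<Delta>\<^sup>3)\<close>, which is where the
  order \<open>n / (d ln\<^sup>2 d)\<close> comes from.\<close>

lemma universal_prob_ge:
  fixes d x :: real and n N \<Delta> :: nat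
  assumes \<Delta>: "1 \<le> \<Delta>" and d: "d > 2 ^ (20 * \<Delta>)"
    and x: "x = real n / d" "10 ^ 15 * real \<Delta> ^ 3 \<le> x"
    and N: "N = nat \<lfloor>1000 * real \<Delta> * x\<rfloor>"
  shows "1 - (exp (- real N) + 4 * root 2 (3 ^ 5 / 2 ^ 3 * (1000 * real \<Delta>) ^ 3 / real N)
        + 4 * root 3 (3 ^ 7 / 2 ^ 4 * (1000 * real \<Delta>) ^ 4 / real N))
    \<le> measure_pmf.prob (gnp n (d / real n))
          {G. \<forall>m F. is_tree m F \<and> max_degree_le m F \<Delta> \<and>
                 real m \<le> (1 / 10 ^ 15) * real n / (d * (ln d)\<^sup>2)
               \<longrightarrow> induced_subgraph m F n G}"
    (is "1 - (_ + 4 * root 2 ?\<alpha>2 + 4 * root 3 ?\<alpha>3) \<le> measure_pmf.prob _ ?good")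
proof -
  define D where "D = 1000 * real \<Delta>"
  define p where "p = d / real n"
  define M where "M = nat \<lfloor>x / (10 ^ 15 * (ln d)\<^sup>2)\<rfloor>"
  \<comment> \<open>The quotient satisfies M \<le> 3 \<Delta> (b + 1), as the count of triggered
    vertices requires, and 3 \<Delta> b \<le> M, which keeps \<open>u0\<close> of order
    \<open>M\<close> up to an additive multiple of \<Delta>.\<close>
  define b where "b = M div (3 * \<Delta>)"
  define u0 where "u0 = M + \<Delta> * b + (b + 1) * (13 + 48 * \<Delta>)"
  define u1 where "u1 = 51 * b + 7"
  have \<Delta>1: "1 \<le> real \<Delta>" using \<Delta> by simp
  then have \<Delta>3: "1 \<le> real \<Delta> ^ 3" by simp
  have x15: "1000000000000000 * real \<Delta> ^ 3 \<le> x" using x(2) by simp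
  then have x0: "100 \<le> x" using \<Delta>3 by linarith
  have d1: "1000 * real \<Delta> \<le> d" using d thousand_le_power[OF \<Delta>] by simp
  then have d0: "0 < d" using \<Delta>1 by simp
  have nx: "real n = x * d" using x(1) d0 by simp
  then have n0: "0 < real n" using x0 d0 by simp
  have px: "p = 1 / x" using nx d0 by (simp add: p_def)
  have p01: "0 \<le> p" "p \<le> 1" using x0 by (auto simp: px)
  have Dx0: "0 \<le> D * x" using x0 by (simp add: D_def)
  have N_le: "real N \<le> D * x" using Dx0 by (simp add: N D_def)
  have N_ge: "D * x - 1 \<le> real N" unfolding N D_def by linarith
  have Dx: "100 \<le> D * x"
    using x0 \<Delta>1 mult_mono[of 1 D 100 x] by (simp add: D_def)
  have N_half: "9 / 10 * (D * x) \<le> real N" using N_ge Dx by linarith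
  have N1: "1 \<le> N" using N_half Dx by linarith
  have Nn: "N \<le> n"
  proof -
    have "D * x \<le> real n" using nx d1 x0 mult_right_mono[of D d x] by (simp add: D_def mult.commute)
    then show ?thesis using N_le by linarith
  qed
  have pN: "p * real N \<le> D" using N_le x0 by (simp add: px field_simps)
  have D1: "1 \<le> D" using \<Delta>1 by (simp add: D_def)
  have L: "real \<Delta> \<le> ln d"
  proof -
    have "exp (real \<Delta>) = exp 1 ^ \<Delta>" by (simp add: exp_of_nat_mult[symmetric])
    also have "\<dots> \<le> (2 ^ 20) ^ \<Delta>" using exp_le by (intro power_mono) auto
    also have "\<dots> < d" using d by (simp add: power_mult)
    finally show ?thesis using d0 by (simp add: ln_ge_iff)
  qed
  have L2: "real \<Delta> ^ 2 \<le> (ln d)\<^sup>2" using L by (intro power_mono) auto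
  have M_le: "real M * (10 ^ 15 * real \<Delta> ^ 2) \<le> x"
  proof -
    have "real M \<le> x / (10 ^ 15 * (ln d)\<^sup>2)" using x0 by (simp add: M_def)
    also have "\<dots> \<le> x / (10 ^ 15 * real \<Delta> ^ 2)"
      using L2 \<Delta>1 x0 by (intro divide_left_mono mult_left_mono mult_pos_pos) auto
    finally show ?thesis using \<Delta>1 by (simp add: field_simps)
  qed
  have bM: "3 * real \<Delta> * real b \<le> real M"
  proof -
    have "3 * \<Delta> * b \<le> M" by (simp add: b_def)
    then have "real (3 * \<Delta> * b) \<le> real M" by (rule of_nat_mono)
    then show ?thesis by simp
  qed
  have Mb: "M \<le> 3 * \<Delta> * (b + 1)"
    using \<Delta> dividend_less_times_div[of "3 * \<Delta>" M] by (simp add: b_def)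
  have u0_le: "real u0 \<le> 22 * real M + 61 * real \<Delta>"
  proof -
    have "real u0 = real M + real \<Delta> * real b + (real b + 1) * (13 + 48 * real \<Delta>)" by (simp add: u0_def algebra_simps)
    also have "\<dots> \<le> real M + real \<Delta> * real b + (real b + 1) * (61 * real \<Delta>)"
      using \<Delta>1 by (intro add_left_mono mult_left_mono) auto
    also have "\<dots> = real M + 62 * (real \<Delta> * real b) + 61 * real \<Delta>" by (simp add: algebra_simps)
    finally show ?thesis using bM by linarith
  qed
  \<comment> \<open>The constant 10^15 is generous: the left side is below 10^(-5) here and below
    1/200 in the next bound. The assumed lower bound on \<open>x\<close> absorbs the additive
    multiples of \<Delta> in \<open>u0\<close> and \<open>u1\<close>.\<close>
  have \<alpha>2: "?\<alpha>2 * real u0 \<le> (1 / 2) ^ 2"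
  proof -
    have "1000000000000000 * (real \<Delta> ^ 2 * real M) \<le> x" using M_le by (simp add: mult_ac)
    moreover have "real \<Delta> ^ 2 * real u0 \<le> 22 * (real \<Delta> ^ 2 * real M) + 61 * real \<Delta> ^ 3"
    proof -
      have "real \<Delta> ^ 2 * real u0 \<le> real \<Delta> ^ 2 * (22 * real M + 61 * real \<Delta>)"
        using u0_le by (intro mult_left_mono) auto
      then show ?thesis by (simp add: algebra_simps power2_eq_square power3_eq_cube)
    qed
    ultimately have *: "10000000000000 * (real \<Delta> ^ 2 * real u0) \<le> x" using x15 x0 by linarith
    have "real \<Delta> * (10000000000000 * (real \<Delta> ^ 2 * real u0)) \<le> real \<Delta> * x" using * by (intro mult_left_mono) auto
    then have "10000000000000 * (real \<Delta> ^ 3 * real u0) \<le> real \<Delta> * x"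
      by (simp add: power2_eq_square power3_eq_cube mult_ac)
    moreover have "9 / 10 * (1000 * (real \<Delta> * x)) \<le> real N" using N_half by (simp add: D_def)
    moreover have "?\<alpha>2 * real u0 = 30375000000 * (real \<Delta> ^ 3 * real u0) / real N"
      by (simp add: power_mult_distrib)
    moreover have "0 < real N" using N1 by simp
    ultimately show ?thesis by (simp add: field_simps)
  qed
  \<comment> \<open>The fourth power costs one more factor \<Delta> than the cube; it is repaid
    because \<open>b\<close>, and with it \<open>u1\<close>, is smaller than \<open>M\<close> by a
    factor of order \<Delta>.\<close>
  have \<alpha>3: "?\<alpha>3 * real u1 \<le> (1 / 2) ^ 3"
  proof -
    have "real \<Delta> * real u1 \<le> 17 * real M + 7 * real \<Delta>" using bM by (simp add: u1_def algebra_simps)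
    then have "real \<Delta> ^ 2 * (real \<Delta> * real u1) \<le> real \<Delta> ^ 2 * (17 * real M + 7 * real \<Delta>)"
      by (intro mult_left_mono) auto
    then have "real \<Delta> ^ 3 * real u1 \<le> 17 * (real \<Delta> ^ 2 * real M) + 7 * real \<Delta> ^ 3"
      by (simp add: algebra_simps power2_eq_square power3_eq_cube)
    moreover have "1000000000000000 * (real \<Delta> ^ 2 * real M) \<le> x" using M_le by (simp add: mult_ac)
    ultimately have *: "1000000000000000 * (real \<Delta> ^ 3 * real u1) \<le> 24 * x" using x15 by linarith
    have "real \<Delta> * (1000000000000000 * (real \<Delta> ^ 3 * real u1)) \<le> real \<Delta> * (24 * x)"
      using * by (intro mult_left_mono) auto
    then have "1000000000000000 * (real \<Delta> ^ 4 * real u1) \<le> 24 * (real \<Delta> * x)"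
      by (simp add: power3_eq_cube power4_eq_xxxx mult_ac)
    moreover have "9 / 10 * (1000 * (real \<Delta> * x)) \<le> real N" using N_half by (simp add: D_def)
    moreover have "?\<alpha>3 * real u1 = 136687500000000 * (real \<Delta> ^ 4 * real u1) / real N"
      by (simp add: power_mult_distrib)
    moreover have "0 < real N" using N1 by simp
    ultimately show ?thesis by (simp add: field_simps)
  qed
  let ?B1 = "{G. card (G \<inter> pairs {0..<N}) < (58 * \<Delta> + 36) * N}"
  let ?B2 = "{G. \<exists>U\<subseteq>{0..<N}. 1 \<le> card U \<and> card U \<le> u0 \<and> (2 + 1) * card U < 2 * card (G \<inter> pairs U)}"
  let ?B3 = "{G. \<exists>U\<subseteq>{0..<N}. 1 \<le> card U \<and> card U \<le> u1 \<and> (3 + 1) * card U < 3 * card (G \<inter> pairs U)}"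
  have P2: "measure_pmf.prob (gnp n p) ?B2 \<le> 4 * root 2 ?\<alpha>2"
    by (rule prob_not_sparse_le[OF _ p01 pN N1 Nn D1 _ \<alpha>2]) (auto simp: D_def)
  have P3: "measure_pmf.prob (gnp n p) ?B3 \<le> 4 * root 3 ?\<alpha>3"
    by (rule prob_not_sparse_le[OF _ p01 pN N1 Nn D1 _ \<alpha>3]) (auto simp: D_def)
  have P1: "measure_pmf.prob (gnp n p) ?B1 \<le> exp (- real N)"
  proof -
    let ?k = "(58 * \<Delta> + 36) * N"
    have "measure_pmf.prob (gnp n p) ?B1 \<le> 2 ^ ?k * (1 - p / 2) ^ (N choose 2)"
      using prob_few_edges_le[OF p01, of "{0..<N}" n ?k] Nn by simp
    also have "\<dots> \<le> exp (real ?k) * exp (- p / 2 * real (N choose 2))"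
    proof (intro mult_mono)
      have "(2::real) ^ ?k \<le> exp 1 ^ ?k" using exp_ge_add_one_self[of 1] by (intro power_mono) auto
      then show "2 ^ ?k \<le> exp (real ?k)" by (simp add: exp_of_nat_mult[symmetric])
      have "(1 - p / 2) ^ (N choose 2) \<le> exp (- p / 2) ^ (N choose 2)"
        using exp_ge_add_one_self[of "- p / 2"] p01 by (intro power_mono) auto
      then show "(1 - p / 2) ^ (N choose 2) \<le> exp (- p / 2 * real (N choose 2))"
        by (simp only: exp_of_nat2_mult)
    qed (use p01 in auto)
    also have "\<dots> = exp (real ?k - p / 2 * real (N choose 2))" by (simp add: exp_add[symmetric])
    also have "\<dots> \<le> exp (- real N)"
    proof -
      have "even (N * (N - 1))" by (cases N) auto
      then have c: "real (N choose 2) = real N * (real N - 1) / 2"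
        using N1 by (simp add: choose_two real_of_nat_div of_nat_diff)
      have "9 / 10 * D \<le> p * real N" using N_half x0 by (simp add: px field_simps)
      moreover have "real N / 2 \<le> real N - 1" using N_half Dx by linarith
      ultimately have "9 / 10 * D * (real N / 2) \<le> p * real N * (real N - 1)"
        by (rule mult_mono) (use N1 p01 in auto)
      \<comment> \<open>Origin of the 1000: 9/80 * 1000 = 112.5 exceeds 95 = 58 + 36 + 1, where 58
        \<Delta> + 36 is the required number of edges per vertex and the last 1 leaves the bound
        exp(-N).\<close>
      then have "9 / 80 * D * real N \<le> p / 2 * real (N choose 2)" by (simp add: c)
      moreover have "real ?k + real N \<le> 95 * (real \<Delta> * real N)"
        using \<Delta>1 mult_right_mono[of 1 "real \<Delta>" "real N"] by (simp add: algebra_simps)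
      moreover have "95 * (real \<Delta> * real N) \<le> 9 / 80 * D * real N" by (simp add: D_def)
      ultimately have "real ?k - p / 2 * real (N choose 2) \<le> - real N" by linarith
      then show ?thesis by simp
    qed
    finally show ?thesis .
  qed
  have sub: "UNIV - ?good \<subseteq> ?B1 \<union> (?B2 \<union> ?B3)"
  proof
    fix G assume G: "G \<in> UNIV - ?good"
    show "G \<in> ?B1 \<union> (?B2 \<union> ?B3)"
    proof (rule ccontr)
      assume nG: "G \<notin> ?B1 \<union> (?B2 \<union> ?B3)"
      have "induced_subgraph m F n G" if F: "is_tree m F" "max_degree_le m F \<Delta>"
          "real m \<le> (1 / 10 ^ 15) * real n / (d * (ln d)\<^sup>2)" for m F
      proof -
        have "real m \<le> x / (10 ^ 15 * (ln d)\<^sup>2)" using F(3) d0 by (simp add: nx)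
        then have m: "m \<le> M" unfolding M_def by (simp add: le_nat_floor)
        have nB: "G \<notin> ?B1" "G \<notin> ?B2" "G \<notin> ?B3" using nG by simp_all
        have dense: "(58 * \<Delta> + 36) * N \<le> card (G \<inter> pairs {0..<N})" using nB(1) by simp
        have s0: "2 * card (G \<inter> pairs U) \<le> 3 * card U"
          if "U \<subseteq> {0..<N}" "1 \<le> card U" "card U \<le> u0" for U
        proof -
          have "\<not> (2 + 1) * card U < 2 * card (G \<inter> pairs U)" using nB(2) that by blast
          then show ?thesis by simp
        qed
        have s1: "3 * card (G \<inter> pairs U) \<le> 4 * card U"
          if "U \<subseteq> {0..<N}" "1 \<le> card U" "card U \<le> u1" for U
        proof -
          have "\<not> (3 + 1) * card U < 3 * card (G \<inter> pairs U)" using nB(3) that by blast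
          then show ?thesis by simp
        qed
        show ?thesis
          using s0 s1 eq_refl[OF u0_def[symmetric]] eq_refl[OF u1_def[symmetric]]
          by (rule trees_induced_if_sparse[OF \<Delta> N1 Nn dense _ _ _ _ Mb F(1,2) m])
      qed
      then show False using G by simp
    qed
  qed
  have "1 - measure_pmf.prob (gnp n (d / real n)) ?good = measure_pmf.prob (gnp n p) (UNIV - ?good)"
    using measure_pmf.prob_compl[of ?good "gnp n p"] by (simp only: p_def sets_measure_pmf UNIV_I space_measure_pmf)
  also have "\<dots> \<le> measure_pmf.prob (gnp n p) (?B1 \<union> (?B2 \<union> ?B3))"
    by (rule measure_pmf.finite_measure_mono[OF sub]) simp
  also have "\<dots> \<le> measure_pmf.prob (gnp n p) ?B1 + measure_pmf.prob (gnp n p) (?B2 \<union> ?B3)"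
    by (rule measure_Un_le) simp_all
  also have "measure_pmf.prob (gnp n p) (?B2 \<union> ?B3) \<le> measure_pmf.prob (gnp n p) ?B2 + measure_pmf.prob (gnp n p) ?B3"
    by (rule measure_Un_le) simp_all
  finally show ?thesis using P1 P2 P3 by linarith
qed

lemma tendsto_universal:
  fixes d :: real
  assumes \<Delta>: "1 \<le> \<Delta>" and d: "d > 2 ^ (20 * \<Delta>)"
  shows "(\<lambda>n. measure_pmf.prob (gnp n (d / real n))
          {G. \<forall>m F. is_tree m F \<and> max_degree_le m F \<Delta> \<and>
                 real m \<le> (1 / 10 ^ 15) * real n / (d * (ln d)\<^sup>2)
               \<longrightarrow> induced_subgraph m F n G}) \<longlonglongrightarrow> 1"
    (is "?f \<longlonglongrightarrow> 1")
proof -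
  define N where "N n = nat \<lfloor>1000 * real \<Delta> * (real n / d)\<rfloor>" for n
  have d0: "0 < d" using d by (rule less_trans[rotated]) simp
  have \<Delta>0: "0 < real \<Delta>" using \<Delta> by simp
  have xinf: "filterlim (\<lambda>n. real n / d) at_top sequentially"
    using filterlim_tendsto_pos_mult_at_top[OF tendsto_const[of "1 / d"] _ filterlim_real_sequentially] d0 by simp
  have Ninf: "filterlim (\<lambda>n. real (N n)) at_top sequentially"
  proof -
    have "filterlim (\<lambda>n. 1000 * real \<Delta> * (real n / d)) at_top sequentially"
      using \<Delta>0 by (intro filterlim_tendsto_pos_mult_at_top[OF tendsto_const _ xinf]) auto
    then have "filterlim (\<lambda>n. -1 + 1000 * real \<Delta> * (real n / d)) at_top sequentially"
      by (intro filterlim_tendsto_add_at_top[OF tendsto_const])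
    then show ?thesis
      by (rule filterlim_at_top_mono) (auto simp: N_def intro!: always_eventually, linarith)
  qed
  define e where "e n = exp (- real (N n)) + 4 * root 2 (3 ^ 5 / 2 ^ 3 * (1000 * real \<Delta>) ^ 3 / real (N n))
        + 4 * root 3 (3 ^ 7 / 2 ^ 4 * (1000 * real \<Delta>) ^ 4 / real (N n))" for n
  have "e \<longlonglongrightarrow> 0 + 4 * root 2 0 + 4 * root 3 0"
    unfolding e_def
  proof (intro tendsto_add tendsto_mult tendsto_const tendsto_real_root)
    show "(\<lambda>n. exp (- real (N n))) \<longlonglongrightarrow> 0"
      using Ninf by (intro filterlim_compose[OF exp_at_bot] filterlim_compose[OF filterlim_uminus_at_bot_at_top])
  qed (intro real_tendsto_divide_at_top[OF tendsto_const Ninf])+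
  then have "(\<lambda>n. 1 - e n) \<longlonglongrightarrow> 1 - 0" by (intro tendsto_diff tendsto_const) simp
  then have lower: "(\<lambda>n. 1 - e n) \<longlonglongrightarrow> 1" by simp
  have "eventually (\<lambda>n. 10 ^ 15 * real \<Delta> ^ 3 \<le> real n / d) sequentially"
    using xinf by (simp add: filterlim_at_top)
  then have "eventually (\<lambda>n. 1 - e n \<le> ?f n) sequentially"
  proof eventually_elim
    case (elim n)
    show ?case unfolding e_def by (rule universal_prob_ge[OF \<Delta> d refl elim N_def])
  qed
  then show ?thesis
    by (rule tendsto_sandwich[OF _ _ lower tendsto_const]) (simp add: always_eventually)
qed

theorem theorem1p4:
  shows "\<exists>C::real. C > 0 \<and>
    (\<forall>(\<Delta>::nat) (d::real). d > 2 ^ (20 * \<Delta>) \<longrightarrow>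
      ((\<lambda>n. measure_pmf.prob (gnp n (d / real n))
          {G. \<forall>m F. is_tree m F \<and> max_degree_le m F \<Delta> \<and>
                 real m \<le> C * real n / (d * (ln d)\<^sup>2)
               \<longrightarrow> induced_subgraph m F n G})
       \<longlonglongrightarrow> 1))"
proof (intro exI[of _ "1 / 10 ^ 15"] conjI allI impI)
  fix \<Delta> :: nat and d :: real
  assume d: "d > 2 ^ (20 * \<Delta>)"
  show "(\<lambda>n. measure_pmf.prob (gnp n (d / real n))
          {G. \<forall>m F. is_tree m F \<and> max_degree_le m F \<Delta> \<and>
                 real m \<le> (1 / 10 ^ 15) * real n / (d * (ln d)\<^sup>2)
               \<longrightarrow> induced_subgraph m F n G}) \<longlonglongrightarrow> 1"
  proof (cases "\<Delta> = 0")
    case False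
    then show ?thesis using d by (intro tendsto_universal) auto
  next
    case True
    \<comment> \<open>For \<Delta> = 0 the only tree is a single vertex, which every graph with n
      \<ge> 1 contains, so the probability is eventually equal to 1.\<close>
    have "induced_subgraph m F n G" if "is_tree m F" "max_degree_le m F 0" "1 \<le> n" for m F n G
    proof -
      have "m = 1" using that single_vertex_of_degree_zero by blast
      then show ?thesis using that(3) unfolding induced_subgraph_def by (intro exI[of _ "\<lambda>_. 0"]) auto
    qed
    then have "measure_pmf.prob (gnp n (d / real n))
          {G. \<forall>m F. is_tree m F \<and> max_degree_le m F \<Delta> \<and>
                 real m \<le> (1 / 10 ^ 15) * real n / (d * (ln d)\<^sup>2)
               \<longrightarrow> induced_subgraph m F n G} = 1" if "1 \<le> n" for n
      using True that by simp
    then show ?thesis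
      by (intro tendsto_eventually) (auto simp: eventually_sequentially)
  qed
qed simp

end
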